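(* Consider, in one space dimension with velocity $u$, the fully discrete scheme which, for $n=0,1,2,\dots$ and given cell values $(\rho_k^n,u_k^n)_k$, determines the stages $(\rho_k^i,u_k^i)_k$, $i=1,\dots,s$, by $$\rho_k^{i}=\rho_k^n - \Delta t_n \sum_{j=1}^{i-1} a_{ij} D (\rho u)_k^{j} - \Delta t_n a_{ii} D (\rho u)_k^{n} + \Delta t_n^2 a_{ii} \sum_{j=1}^{i-1} \tilde{a}_{ij} D^2 (\rho u^2 )_k^{j} + \frac{\Delta t_n^2}{\epsilon^2} a_{ii} \sum_{j=1}^i a_{ij} D^2 (p)_k^{j},$$ $$(\rho u)_k^{i} = (\rho u)_k^{n} - \Delta t_n \sum_{j=1}^{i-1} \tilde{a}_{ij} D_1 (\rho u^2 )_k^{j} - \frac{\Delta t_n}{\epsilon^2} \sum_{j=1}^i a_{ij} D_{cen} (p)_k^{j},$$ and sets $(\rho^{n+1}_k,u^{n+1}_k)=(\rho^s_k,u^s_k)$, where $D$ is $D_{cen}$ or $D_{upw}$, and $D_1$ is $D_{upw}$ or $D_{ES}$. Assume that $\rho$ and $u$ satisfy periodic boundary conditions, that the initial conditions are well-prepared, i.e. $$\rho(x,0)=\rho_{(0)}^0+\epsilon^2\rho_{(2)}^0(x),\qquad u(x,0)=u_{(0)}^0(x)+\epsilon\,u_{(1)}^0(x),$$ with $\rho_{(0)}^0$ constant and $\partial_x u_{(0)}^0=0$, and that $\rho,u,p$ at all time levels and stages admit the asymptotic expansions $$\rho=\rho_{(0)}+\epsilon\rho_{(1)}+\epsilon^2\rho_{(2)}+\dots,\quad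 u=u_{(0)}+\epsilon u_{(1)}+\epsilon^2u_{(2)}+\dots,\quad p=p_{(0)}+\epsilon p_{(1)}+\epsilon^2p_{(2)}+\dots$$ Then, for $\epsilon\to0$ (that is, upon balancing equal powers of $\epsilon$), a solution of the scheme satisfies $$(\rho_{(0)})_k^i\equiv\text{constant},\qquad (\rho_{(1)})_k^i\equiv\text{constant},\qquad (\rho_{(0)})_k^i+\epsilon(\rho_{(1)})_k^i=\rho_0,$$ $$(u_{(0)})_k^{i} = (u_{(0)})_k^{n} - \Delta t_n \sum_{j=1}^{i-1} \tilde{a}_{ij} D_1 ( u_{(0)}^2)_k^{j} - \frac{\Delta t_n}{\rho_0} \sum_{j=1}^i a_{ij} D_{cen} (p_{(2)})_k^{j},$$ for all cells $k=1,2,\dots$ and all $i\in\{1,2,\dots,s\}$ (and every $n$), where $\rho_0:=(\rho_{(0)})_k^0+\epsilon(\rho_{(1)})_k^0$ (for any $k$) is the constant given by the initial data.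
   Context: The scheme discretises the dimensionless barotropic Euler system in one space dimension, $\partial_t\rho+\partial_x(\rho u)=0$, $\partial_t(\rho u)+\partial_x(\rho u^2)+\frac1{\epsilon^2}\partial_x p(\rho)=0$, with $\rho>0$, $p(\rho)=\kappa\rho^\gamma$, constants $\kappa>0$, $\gamma>1$, and $\epsilon>0$ proportional to the Mach number. IMEX-RK coefficients. They are given by matrices $\tilde A=(\tilde a_{ij}),A=(a_{ij})\in\mathbb R^{s\times s}$ and vectors $\tilde b,b,\tilde c,c\in\mathbb R^s$, where $\tilde A$ is strictly lower triangular, $A$ is lower triangular with non-zero diagonal entries, $\tilde c_i=\sum_{j=1}^{i-1}\tilde a_{ij}$, $c_i=\sum_{j=1}^i a_{ij}$. The scheme is globally stiffly accurate (GSA): $c_s=\tilde c_s=1$ and $a_{sj}=b_j$, $\tilde a_{sj}=\tilde b_j$ for all $j$; hence the update at $t_{n+1}$ equals the $s$-th stage. $\Delta t_n=t_{n+1}-t_n>0$. Space discretisation. The domain is divided into finitely many cells $k=1,\dots,N$ of length $\Delta x_k>0$, with indices understood periodically; $d_{k+1/2}>0$ is the distance between the centres of cells $k$ and $k+1$. Discrete unknowns are piecewise constant (initial data are projected by cell averages). For a grid function $\phi$, put $\{\phi\}_{k+1/2}=\frac{\phi_k+\phi_{k+1}}2$, $[\phi]_{k+1/2}=\phi_{k+1}-\phi_k$, and for $a\in\mathbb R$, $[a]^\pm=\frac{a\pm|a|}2$. The discrete operators are: - central first derivative: $D_{cen}(\phi)_k=\frac{1}{\Delta x_k}\left(\{\phi\}_{k+1/2}-\{\phi\}_{k-1/2}\right)$;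 - upwind: $D_{upw}(\rho u)_k=\frac1{\Delta x_k}(F_{k+1/2}-F_{k-1/2})$ with $F_{k+1/2}=\rho_k[\{u\}_{k+1/2}]^++\rho_{k+1}[\{u\}_{k+1/2}]^-$, and $D_{upw}(\rho u^2)_k=\frac1{\Delta x_k}(H_{k+1/2}-H_{k-1/2})$ with $H_{k+1/2}=\rho_ku_k[\{u\}_{k+1/2}]^++\rho_{k+1}u_{k+1}[\{u\}_{k+1/2}]^-$; - entropy stable: $D_{ES}(\rho u^2)_k=\frac1{\Delta x_k}(E_{k+1/2}-E_{k-1/2})$ with $E_{k+1/2}=\{\rho\}^\gamma_{k+1/2}\{u\}_{k+1/2}^2-\frac q2\,|\{u\}_{k+1/2}|\,J_{k+1/2}$, where $q>0$ is a constant, $\{\rho\}^\gamma_{k+1/2}=\frac{\gamma-1}{\gamma}\frac{[\rho^\gamma]_{k+1/2}}{[\rho^{\gamma-1}]_{k+1/2}}$ (understood as the common value $\rho_k$ if $\rho_k=\rho_{k+1}$), and $J_{k+1/2}=[u]_{k+1/2}$ (first order version) or $J_{k+1/2}=\langle\langle u\rangle\rangle_{k+1/2}$ (second order version). Here $\langle\langle u\rangle\rangle_{k+1/2}=(u_{k+1}-\frac12 m_{k+1})-(u_k+\frac12m_k)$ is the interface jump of the min-mod piecewise linear reconstruction, $m_k=\mathrm{minmod}(u_k-u_{k-1},u_{k+1}-u_k)$, where $\mathrm{minmod}(a,b)$ is the argument of smaller absolute value if $ab>0$ and $0$ otherwise; - second derivatives: $D^2(\rho u^2)_k=D_{cen}(D_{cen}(\rho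 u^2))_k$ and $D^2(p)_k=\frac1{\Delta x_k}\left(\frac{[p]_{k+1/2}}{d_{k+1/2}}-\frac{[p]_{k-1/2}}{d_{k-1/2}}\right)$. In the limit relation, $D_1(u_{(0)}^2)$ denotes $\frac1{\bar\rho}D_1(\bar\rho\,u_{(0)}^2)$, the operator evaluated with constant density $\bar\rho=\rho_0$ and velocity $u_{(0)}$, divided by that constant density. Notation. A superscript $n$ denotes the value at time level $t_n$; superscripts $i,j$ denote stages of the current step; superscript $0$ on expansion coefficients of initial data denotes the initial time; $p_k^j=p(\rho_k^j)$. A parenthesised subscript $(m)$ denotes the coefficient of $\epsilon^m$ in the asymptotic expansion; the expansion of $p$ is that of $\kappa\rho^\gamma$, so $p_{(0)}=\kappa\rho_{(0)}^\gamma$. The asymptotics is formal: expansions are inserted into the scheme and terms with equal powers of $\epsilon$ are equated. *)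

theory Defs
  imports "HOL-Analysis.Analysis" "HOL-Library.Landau_Symbols"
begin

text \<open>Stages are numbered \<open>1, \<dots>, s\<close>; entries outside that range are irrelevant.\<close>

definition gsa_imex_rk ::
  "nat \<Rightarrow> (nat \<Rightarrow> nat \<Rightarrow> real) \<Rightarrow> (nat \<Rightarrow> nat \<Rightarrow> real) \<Rightarrow>
   (nat \<Rightarrow> real) \<Rightarrow> (nat \<Rightarrow> real) \<Rightarrow> (nat \<Rightarrow> real) \<Rightarrow> (nat \<Rightarrow> real) \<Rightarrow> bool"
where
  "gsa_imex_rk s At A bt b ct c \<longleftrightarrow>
     1 \<le> s \<and>
     (\<forall>i\<in>{1..s}. \<forall>j\<in>{1..s}. i \<le> j \<longrightarrow> At i j = 0) \<and>
     (\<forall>i\<in>{1..s}. \<forall>j\<in>{1..s}. i < j \<longrightarrow> A i j = 0) \<and>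
     (\<forall>i\<in>{1..s}. A i i \<noteq> 0) \<and>
     (\<forall>i\<in>{1..s}. ct i = (\<Sum>j=1..<i. At i j)) \<and>
     (\<forall>i\<in>{1..s}. c i = (\<Sum>j=1..i. A i j)) \<and>
     c s = 1 \<and> ct s = 1 \<and>
     (\<forall>j\<in>{1..s}. A s j = b j \<and> At s j = bt j)"

text \<open>
  Grid functions are functions on the integers, to be thought of as \<open>N\<close>-periodic.
  The mesh is given by its interfaces: \<open>xf k\<close> is \<open>x\<^sub>k\<^sub>+\<^sub>1\<^sub>/\<^sub>2\<close>, so that cell \<open>k\<close> is the interval
  from \<open>xf (k - 1)\<close> to \<open>xf k\<close>.  Likewise a quantity living on interfaces takes
  at the argument \<open>k\<close> its value at \<open>k + 1/2\<close>.
\<close>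

type_synonym grid = "int \<Rightarrow> real"

definition periodic_grid :: "nat \<Rightarrow> grid \<Rightarrow> bool" where
  "periodic_grid N \<phi> \<longleftrightarrow> (\<forall>k. \<phi> (k + int N) = \<phi> k)"

text \<open>The domain has length \<open>L\<close> and is extended periodically.\<close>

definition periodic_mesh :: "nat \<Rightarrow> real \<Rightarrow> grid \<Rightarrow> bool" where
  "periodic_mesh N L xf \<longleftrightarrow>
     1 \<le> N \<and> (\<forall>k. xf (k - 1) < xf k) \<and> (\<forall>k. xf (k + int N) = xf k + L)"

definition cell_length :: "grid \<Rightarrow> grid" where
  "cell_length xf k = xf k - xf (k - 1)"

definition centre :: "grid \<Rightarrow> grid" where
  "centre xf k = (xf (k - 1) + xf k) / 2"

definition centre_dist :: "grid \<Rightarrow> grid" where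
  "centre_dist xf k = centre xf (k + 1) - centre xf k"

definition cell_average :: "grid \<Rightarrow> (real \<Rightarrow> real) \<Rightarrow> grid" where
  "cell_average xf f k = integral {xf (k - 1)..xf k} f / cell_length xf k"

definition avg :: "grid \<Rightarrow> grid" where
  "avg \<phi> k = (\<phi> k + \<phi> (k + 1)) / 2"

definition jump :: "grid \<Rightarrow> grid" where
  "jump \<phi> k = \<phi> (k + 1) - \<phi> k"

definition pos_part :: "real \<Rightarrow> real" where
  "pos_part a = (a + \<bar>a\<bar>) / 2"

text \<open>The value is nonpositive: the part is \<open>min a 0\<close>, not its absolute value.\<close>

definition neg_part :: "real \<Rightarrow> real" where
  "neg_part a = (a - \<bar>a\<bar>) / 2"

definition flux_diff :: "grid \<Rightarrow> grid \<Rightarrow> grid" where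
  "flux_diff xf F k = (F k - F (k - 1)) / cell_length xf k"

definition D_cen :: "grid \<Rightarrow> grid \<Rightarrow> grid" where
  "D_cen xf \<phi> = flux_diff xf (avg \<phi>)"

text \<open>
  The operators below act on the pair \<open>\<rho>\<close>, \<open>u\<close>: the suffix \<open>mass\<close> stands for
  \<open>D(\<rho>u)\<close> and the suffix \<open>mom\<close> for \<open>D(\<rho>u\<^sup>2)\<close>.
\<close>

definition D_cen_mass :: "grid \<Rightarrow> grid \<Rightarrow> grid \<Rightarrow> grid" where
  "D_cen_mass xf \<rho> u = D_cen xf (\<lambda>k. \<rho> k * u k)"

definition D_upw_mass :: "grid \<Rightarrow> grid \<Rightarrow> grid \<Rightarrow> grid" where
  "D_upw_mass xf \<rho> u = flux_diff xf
     (\<lambda>k. \<rho> k * pos_part (avg u k) + \<rho> (k + 1) * neg_part (avg u k))"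

definition D_upw_mom :: "grid \<Rightarrow> grid \<Rightarrow> grid \<Rightarrow> grid" where
  "D_upw_mom xf \<rho> u = flux_diff xf
     (\<lambda>k. \<rho> k * u k * pos_part (avg u k) + \<rho> (k + 1) * u (k + 1) * neg_part (avg u k))"

definition gamma_mean :: "real \<Rightarrow> grid \<Rightarrow> grid" where
  "gamma_mean \<gamma> \<rho> k =
     (if \<rho> k = \<rho> (k + 1) then \<rho> k
      else (\<gamma> - 1) / \<gamma> * (jump (\<lambda>l. \<rho> l powr \<gamma>) k / jump (\<lambda>l. \<rho> l powr (\<gamma> - 1)) k))"

definition minmod :: "real \<Rightarrow> real \<Rightarrow> real" where
  "minmod a b = (if a * b > 0 then (if \<bar>a\<bar> \<le> \<bar>b\<bar> then a else b) else 0)"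

definition slope :: "grid \<Rightarrow> grid" where
  "slope u k = minmod (u k - u (k - 1)) (u (k + 1) - u k)"

definition reconstructed_jump :: "grid \<Rightarrow> grid" where
  "reconstructed_jump u k = (u (k + 1) - slope u (k + 1) / 2) - (u k + slope u k / 2)"

text \<open>
  The parameter \<open>J\<close> is \<^const>\<open>jump\<close> for the first order version and
  \<^const>\<open>reconstructed_jump\<close> for the second order version.
\<close>

definition D_ES_mom ::
  "(grid \<Rightarrow> grid) \<Rightarrow> real \<Rightarrow> real \<Rightarrow> grid \<Rightarrow> grid \<Rightarrow> grid \<Rightarrow> grid" where
  "D_ES_mom J \<gamma> q xf \<rho> u = flux_diff xf
     (\<lambda>k. gamma_mean \<gamma> \<rho> k * (avg u k)\<^sup>2 - q / 2 * \<bar>avg u k\<bar> * J u k)"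

definition D2_mom :: "grid \<Rightarrow> grid \<Rightarrow> grid \<Rightarrow> grid" where
  "D2_mom xf \<rho> u = D_cen xf (D_cen xf (\<lambda>k. \<rho> k * (u k)\<^sup>2))"

definition D2_pressure :: "grid \<Rightarrow> grid \<Rightarrow> grid" where
  "D2_pressure xf p = flux_diff xf (\<lambda>k. jump p k / centre_dist xf k)"

definition pressure :: "real \<Rightarrow> real \<Rightarrow> real \<Rightarrow> real" where
  "pressure \<kappa> \<gamma> r = \<kappa> * r powr \<gamma>"

text \<open>
  Right-hand sides of the density and momentum equations at stage \<open>i\<close>;
  \<open>\<rho>n\<close>, \<open>un\<close> are the values at \<open>t\<^sub>n\<close> and \<open>\<rho>s j\<close>, \<open>us j\<close> those at stage \<open>j\<close>.
\<close>

definition density_rhs ::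
  "grid \<Rightarrow> (nat \<Rightarrow> nat \<Rightarrow> real) \<Rightarrow> (nat \<Rightarrow> nat \<Rightarrow> real) \<Rightarrow> (grid \<Rightarrow> grid \<Rightarrow> grid) \<Rightarrow>
   (real \<Rightarrow> real) \<Rightarrow> real \<Rightarrow> real \<Rightarrow> grid \<Rightarrow> grid \<Rightarrow> (nat \<Rightarrow> grid) \<Rightarrow> (nat \<Rightarrow> grid) \<Rightarrow> nat \<Rightarrow> grid"
where
  "density_rhs xf At A D p dt \<epsilon> \<rho>n un \<rho>s us i k =
     \<rho>n k
     - dt * (\<Sum>j=1..<i. A i j * D (\<rho>s j) (us j) k)
     - dt * A i i * D \<rho>n un k
     + dt\<^sup>2 * A i i * (\<Sum>j=1..<i. At i j * D2_mom xf (\<rho>s j) (us j) k)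
     + dt\<^sup>2 / \<epsilon>\<^sup>2 * A i i * (\<Sum>j=1..i. A i j * D2_pressure xf (\<lambda>l. p (\<rho>s j l)) k)"

definition momentum_rhs ::
  "grid \<Rightarrow> (nat \<Rightarrow> nat \<Rightarrow> real) \<Rightarrow> (nat \<Rightarrow> nat \<Rightarrow> real) \<Rightarrow> (grid \<Rightarrow> grid \<Rightarrow> grid) \<Rightarrow>
   (real \<Rightarrow> real) \<Rightarrow> real \<Rightarrow> real \<Rightarrow> grid \<Rightarrow> grid \<Rightarrow> (nat \<Rightarrow> grid) \<Rightarrow> (nat \<Rightarrow> grid) \<Rightarrow> nat \<Rightarrow> grid"
where
  "momentum_rhs xf At A D1 p dt \<epsilon> \<rho>n un \<rho>s us i k =
     \<rho>n k * un k
     - dt * (\<Sum>j=1..<i. At i j * D1 (\<rho>s j) (us j) k)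
     - dt / \<epsilon>\<^sup>2 * (\<Sum>j=1..i. A i j * D_cen xf (\<lambda>l. p (\<rho>s j l)) k)"

text \<open>\<open>f \<epsilon> = c 0 + \<epsilon> c 1 + \<epsilon>\<^sup>2 c 2 + \<dots>\<close> as \<open>\<epsilon>\<close> tends to 0 from above, to every order; the
  series need not converge.\<close>

definition has_expansion :: "(real \<Rightarrow> real) \<Rightarrow> (nat \<Rightarrow> real) \<Rightarrow> bool" where
  "has_expansion f c \<longleftrightarrow>
     (\<forall>M. (\<lambda>\<epsilon>. f \<epsilon> - (\<Sum>m\<le>M. c m * \<epsilon> ^ m)) \<in> o[at_right 0](\<lambda>\<epsilon>. \<epsilon> ^ M))"

text \<open>
  Formal equality: the two sides differ by less than every power of \<open>\<epsilon>\<close>, that is,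
  there is no power of \<open>\<epsilon>\<close> at which they fail to balance.  Imposing the scheme in this
  sense admits genuine solutions, for which the two sides coincide
  (lemma \<open>formally_equalI\<close>), and also purely formal ones: a formal power series solution
  is the expansion of some smooth family (Borel), which satisfies the scheme
  only up to such terms.
\<close>

definition formally_equal :: "(real \<Rightarrow> real) \<Rightarrow> (real \<Rightarrow> real) \<Rightarrow> bool" where
  "formally_equal f g \<longleftrightarrow> (\<forall>M. (\<lambda>\<epsilon>. f \<epsilon> - g \<epsilon>) \<in> o[at_right 0](\<lambda>\<epsilon>. \<epsilon> ^ M))"

lemma formally_equalI:
  assumes "\<forall>\<^sub>F \<epsilon> in at_right 0. f \<epsilon> = g \<epsilon>"
  shows "formally_equal f g"
  unfolding formally_equal_def
proof
  fix M :: nat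
  have "\<forall>\<^sub>F \<epsilon> in at_right 0. f \<epsilon> - g \<epsilon> = 0"
    using assms by eventually_elim simp
  then show "(\<lambda>\<epsilon>. f \<epsilon> - g \<epsilon>) \<in> o[at_right 0](\<lambda>\<epsilon>. \<epsilon> ^ M)"
    by (subst landau_o.small.in_cong, assumption) simp
qed

end

theory Submission
  imports Defs
begin

text \<open>
  The density equation carries the factor \<open>1/\<epsilon>\<^sup>2\<close> only in front of the discrete Laplacian of
  the pressure.  Balancing the orders \<open>\<epsilon>\<^sup>-\<^sup>2\<close> and \<open>\<epsilon>\<^sup>-\<^sup>1\<close>, and going through the stages one by
  one (\<open>A\<close> is lower triangular with non-zero diagonal), shows that the Laplacians of
  \<open>p\<^sub>(\<^sub>0\<^sub>)\<close> and \<open>p\<^sub>(\<^sub>1\<^sub>)\<close> vanish at every stage (\<open>stage_pressure_laplacian_tendsto\<close>); by periodicity both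
  coefficients are constant in space (\<open>D2_pressure_eq_0_imp_const\<close>).  The pressure law carries this over to \<open>\<rho>\<^sub>(\<^sub>0\<^sub>)\<close>, as it is injective, and to \<open>\<rho>\<^sub>(\<^sub>1\<^sub>)\<close>, as
  its derivative at \<open>\<rho>\<^sub>(\<^sub>0\<^sub>) > 0\<close> is positive.  All operators in the density equation are
  differences of periodic fluxes, so total mass is conserved at every order (\<open>total_mass_density_rhs\<close>), and a
  spatially constant coefficient keeps the constant it had at the previous time level.
  Well-prepared data start with the constants \<open>\<rho>\<^sup>0\<^sub>(\<^sub>0\<^sub>)\<close> and \<open>0\<close>, and by global stiff accuracy
  the last stage is the next time level, so induction over the time levels covers all of
  them.

  In the momentum equation the central difference annihilates the spatially constant
  \<open>p\<^sub>(\<^sub>0\<^sub>)\<close> and \<open>p\<^sub>(\<^sub>1\<^sub>)\<close>, so that the pressure term divided by \<open>\<epsilon>\<^sup>2\<close> tends to the difference of \<open>p\<^sub>(\<^sub>2\<^sub>)\<close>.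
  The remaining terms converge because the discrete operators are continuous in
  the grid values; the entropy stable flux needs an argument, since its density mean is a
  quotient that degenerates at equal densities (\<open>gamma_mean_between\<close>).  The limit, divided by the constant density,
  is the asserted relation for \<open>u\<^sub>(\<^sub>0\<^sub>)\<close>.
\<close>

section \<open>Asymptotic expansions\<close>

lemma formally_equal_tendsto_0:
  assumes "formally_equal f g"
  shows "((\<lambda>\<epsilon>. f \<epsilon> - g \<epsilon>) \<longlongrightarrow> 0) (at_right 0)"
proof -
  have "(\<lambda>\<epsilon>. f \<epsilon> - g \<epsilon>) \<in> o[at_right 0](\<lambda>\<epsilon>. \<epsilon> ^ 0)"
    using assms unfolding formally_equal_def by blast
  from smalloD_tendsto[OF this] show ?thesis by simp
qed

lemma formally_equal_trans:
  assumes "formally_equal f g" "formally_equal g h"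
  shows "formally_equal f h"
  unfolding formally_equal_def
proof
  fix M :: nat
  have "(\<lambda>\<epsilon>. (f \<epsilon> - g \<epsilon>) + (g \<epsilon> - h \<epsilon>)) \<in> o[at_right 0](\<lambda>\<epsilon>. \<epsilon> ^ M)"
    using assms unfolding formally_equal_def by (intro sum_in_smallo(1)) auto
  then show "(\<lambda>\<epsilon>. f \<epsilon> - h \<epsilon>) \<in> o[at_right 0](\<lambda>\<epsilon>. \<epsilon> ^ M)" by simp
qed

lemma formally_equal_weighted_sum:
  assumes "\<And>i. i \<in> I \<Longrightarrow> formally_equal (f i) (g i)"
  shows "formally_equal (\<lambda>\<epsilon>. \<Sum>i\<in>I. a i * f i \<epsilon>) (\<lambda>\<epsilon>. \<Sum>i\<in>I. a i * g i \<epsilon>)"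
  unfolding formally_equal_def
proof
  fix M :: nat
  have "(\<lambda>\<epsilon>. \<Sum>i\<in>I. a i * (f i \<epsilon> - g i \<epsilon>)) \<in> o[at_right 0](\<lambda>\<epsilon>. \<epsilon> ^ M)"
    using assms unfolding formally_equal_def
    by (intro big_sum_in_smallo landau_o.small.cmult_in_iff') (auto simp: landau_o.small.cmult_in_iff')
  then show "(\<lambda>\<epsilon>. (\<Sum>i\<in>I. a i * f i \<epsilon>) - (\<Sum>i\<in>I. a i * g i \<epsilon>))
      \<in> o[at_right 0](\<lambda>\<epsilon>. \<epsilon> ^ M)"
    by (simp add: right_diff_distrib sum_subtractf)
qed

lemma has_expansion_weighted_sum:
  assumes "\<And>i. i \<in> I \<Longrightarrow> has_expansion (f i) (c i)"
  shows "has_expansion (\<lambda>\<epsilon>. \<Sum>i\<in>I. a i * f i \<epsilon>) (\<lambda>m. \<Sum>i\<in>I. a i * c i m)"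
  unfolding has_expansion_def
proof
  fix M :: nat
  have "(\<lambda>\<epsilon>. \<Sum>i\<in>I. a i * (f i \<epsilon> - (\<Sum>m\<le>M. c i m * \<epsilon> ^ m)))
      \<in> o[at_right 0](\<lambda>\<epsilon>. \<epsilon> ^ M)"
    using assms unfolding has_expansion_def
    by (intro big_sum_in_smallo) (cases "\<exists>i. a i = 0"; auto)
  moreover have "(\<Sum>i\<in>I. a i * (f i \<epsilon> - (\<Sum>m\<le>M. c i m * \<epsilon> ^ m))) =
      (\<Sum>i\<in>I. a i * f i \<epsilon>) - (\<Sum>m\<le>M. (\<Sum>i\<in>I. a i * c i m) * \<epsilon> ^ m)" for \<epsilon>
    by (simp add: right_diff_distrib sum_subtractf sum_distrib_left sum_distrib_right
        mult.assoc sum.swap[of _ I])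
  ultimately show "(\<lambda>\<epsilon>. (\<Sum>i\<in>I. a i * f i \<epsilon>) - (\<Sum>m\<le>M. (\<Sum>i\<in>I. a i * c i m) * \<epsilon> ^ m))
      \<in> o[at_right 0](\<lambda>\<epsilon>. \<epsilon> ^ M)"
    by simp
qed

lemma has_expansion_coeff_tendsto:
  assumes "has_expansion f c"
  shows "((\<lambda>\<epsilon>. (f \<epsilon> - (\<Sum>m<M. c m * \<epsilon> ^ m)) / \<epsilon> ^ M) \<longlongrightarrow> c M) (at_right 0)"
proof -
  have "(\<lambda>\<epsilon>. f \<epsilon> - (\<Sum>m\<le>M. c m * \<epsilon> ^ m)) \<in> o[at_right 0](\<lambda>\<epsilon>. \<epsilon> ^ M)"
    using assms unfolding has_expansion_def by blast
  from tendsto_add[OF smalloD_tendsto[OF this] tendsto_const[of "c M"]]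
  have "((\<lambda>\<epsilon>. (f \<epsilon> - (\<Sum>m\<le>M. c m * \<epsilon> ^ m)) / \<epsilon> ^ M + c M) \<longlongrightarrow> c M) (at_right 0)"
    by simp
  then show ?thesis
    by (rule Lim_transform_eventually)
      (use eventually_at_right_less[of "0::real"] in eventually_elim,
       simp add: lessThan_Suc_atMost[symmetric] field_simps)
qed

lemma has_expansion_tendsto_0:
  assumes "has_expansion f c"
  shows "(f \<longlongrightarrow> c 0) (at_right 0)"
  using has_expansion_coeff_tendsto[OF assms, of 0] by simp

lemma has_expansion_tendsto_1:
  assumes "has_expansion f c"
  shows "((\<lambda>\<epsilon>. (f \<epsilon> - c 0) / \<epsilon>) \<longlongrightarrow> c 1) (at_right 0)"
  using has_expansion_coeff_tendsto[OF assms, of 1] by simp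

lemma has_expansion_tendsto_2:
  assumes "has_expansion f c"
  shows "((\<lambda>\<epsilon>. (f \<epsilon> - (c 0 + c 1 * \<epsilon>)) / \<epsilon>\<^sup>2) \<longlongrightarrow> c 2) (at_right 0)"
  using has_expansion_coeff_tendsto[OF assms, of 2] by (simp add: numeral_2_eq_2)

text \<open>Coefficients are determined by the formal equality class of a function; for \<open>f = g\<close> this is
  uniqueness of the expansion.\<close>

lemma formally_equal_imp_coeffs_eq:
  assumes fg: "formally_equal f g" and f: "has_expansion f c" and g: "has_expansion g d"
  shows "c m = d m"
proof (induction m rule: less_induct)
  case (less M)
  have "(\<lambda>\<epsilon>. f \<epsilon> - g \<epsilon>) \<in> o[at_right 0](\<lambda>\<epsilon>. \<epsilon> ^ M)"
    using fg unfolding formally_equal_def by blast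
  from tendsto_add[OF smalloD_tendsto[OF this] has_expansion_coeff_tendsto[OF g, of M]]
  have "((\<lambda>\<epsilon>. (f \<epsilon> - g \<epsilon>) / \<epsilon> ^ M + (g \<epsilon> - (\<Sum>m<M. c m * \<epsilon> ^ m)) / \<epsilon> ^ M) \<longlongrightarrow> d M)
      (at_right 0)"
    using less by simp
  then have "((\<lambda>\<epsilon>. (f \<epsilon> - (\<Sum>m<M. c m * \<epsilon> ^ m)) / \<epsilon> ^ M) \<longlongrightarrow> d M) (at_right 0)"
    by (simp add: add_divide_distrib[symmetric])
  from tendsto_unique[OF _ has_expansion_coeff_tendsto[OF f] this] show ?case by simp
qed

lemma eventually_eq_imp_coeffs_eq:
  assumes "\<forall>\<^sub>F \<epsilon> in at_right 0. f \<epsilon> = g \<epsilon>" "has_expansion f c" "has_expansion g d"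
  shows "c m = d m"
  using formally_equal_imp_coeffs_eq[OF formally_equalI] assms by blast

text \<open>First-order Taylor expansion of a composition as \<open>\<epsilon>\<close> tends to 0 from above.\<close>

lemma difference_quotient_compose_tendsto:
  fixes f g :: "real \<Rightarrow> real"
  assumes f: "((\<lambda>\<epsilon>. (f \<epsilon> - R) / \<epsilon>) \<longlongrightarrow> d) (at_right 0)"
    and g: "(g has_real_derivative g') (at R)"
  shows "((\<lambda>\<epsilon>. (g (f \<epsilon>) - g R) / \<epsilon>) \<longlongrightarrow> g' * d) (at_right 0)"
proof -
  \<comment> \<open>Nothing is known about \<open>f 0\<close>: redefining it as \<open>R\<close> turns the limit into a derivative at 0.\<close>
  define F where "F = (\<lambda>\<epsilon>. if \<epsilon> = 0 then R else f \<epsilon>)"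
  have ev: "\<forall>\<^sub>F \<epsilon> in at_right 0. \<epsilon> \<noteq> (0::real)"
    using eventually_at_right_less[of "0::real"] by eventually_elim simp
  have "(F has_real_derivative d) (at_right 0)"
    unfolding has_field_derivative_iff
    by (rule Lim_transform_eventually[OF f], use ev in eventually_elim) (simp add: F_def)
  then have "((\<lambda>\<epsilon>. g (F \<epsilon>)) has_real_derivative g' * d) (at_right 0)"
    using DERIV_chain'[of F d 0 "{0<..}" g g'] g by (simp add: F_def)
  then show ?thesis
    unfolding has_field_derivative_iff
    by (rule Lim_transform_eventually, use ev in eventually_elim) (simp add: F_def)
qed

section \<open>Discrete operators on a periodic mesh\<close>

lemma cell_length_pos: "periodic_mesh N L xf \<Longrightarrow> cell_length xf k > 0"
  by (simp add: periodic_mesh_def cell_length_def)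

lemma centre_dist_pos:
  assumes "periodic_mesh N L xf"
  shows "centre_dist xf k > 0"
proof -
  have "xf (k - 1) < xf k" "xf (k + 1 - 1) < xf (k + 1)"
    using assms unfolding periodic_mesh_def by blast+
  then show ?thesis by (simp add: centre_dist_def centre_def)
qed

lemma periodic_grid_cell_length:
  assumes "periodic_mesh N L xf"
  shows "periodic_grid N (cell_length xf)"
proof -
  have "xf (k + int N) = xf k + L" for k using assms by (simp add: periodic_mesh_def)
  from this[of "_ - 1"] this show ?thesis
    by (simp add: periodic_grid_def cell_length_def algebra_simps)
qed

lemma periodic_gridD:
  assumes "periodic_grid N \<phi>"
  shows "\<phi> (k + int N) = \<phi> k" "\<phi> (k + int N + 1) = \<phi> (k + 1)" "\<phi> (k + int N - 1) = \<phi> (k - 1)"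
proof -
  have *: "\<phi> (k + int N) = \<phi> k" for k using assms by (simp add: periodic_grid_def)
  show "\<phi> (k + int N) = \<phi> k" by (rule *)
  show "\<phi> (k + int N + 1) = \<phi> (k + 1)" using *[of "k + 1"] by (simp add: algebra_simps)
  show "\<phi> (k + int N - 1) = \<phi> (k - 1)" using *[of "k - 1"] by (simp add: algebra_simps)
qed

lemma periodic_grid_avg: "periodic_grid N \<phi> \<Longrightarrow> periodic_grid N (avg \<phi>)"
  by (simp add: periodic_grid_def[of N "avg \<phi>"] avg_def periodic_gridD)

lemma periodic_grid_flux_diff:
  "periodic_mesh N L xf \<Longrightarrow> periodic_grid N F \<Longrightarrow> periodic_grid N (flux_diff xf F)"
  using periodic_gridD[OF periodic_grid_cell_length]
  by (simp add: periodic_grid_def[of N "flux_diff xf F"] flux_diff_def periodic_gridD)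

text \<open>The total mass of a grid function over the \<open>N\<close> cells \<open>1, \<dots>, N\<close> of one period.\<close>

definition total_mass :: "nat \<Rightarrow> grid \<Rightarrow> grid \<Rightarrow> real" where
  "total_mass N xf \<phi> = (\<Sum>m<N. cell_length xf (int (Suc m)) * \<phi> (int (Suc m)))"

lemma total_mass_linear:
  "total_mass N xf (\<lambda>k. f k + g k) = total_mass N xf f + total_mass N xf g"
  "total_mass N xf (\<lambda>k. f k - g k) = total_mass N xf f - total_mass N xf g"
  "total_mass N xf (\<lambda>k. a * f k) = a * total_mass N xf f"
  "total_mass N xf (\<lambda>k. \<Sum>j\<in>J. h j k) = (\<Sum>j\<in>J. total_mass N xf (h j))"
  by (simp_all add: total_mass_def algebra_simps sum.distrib sum_subtractf sum_distrib_left
      sum.swap[of _ J])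

lemma total_mass_flux_diff:
  assumes "periodic_mesh N L xf" "periodic_grid N F"
  shows "total_mass N xf (flux_diff xf F) = 0"
proof -
  have "total_mass N xf (flux_diff xf F) = (\<Sum>m<N. F (int (Suc m)) - F (int m))"
    using cell_length_pos[OF assms(1)]
    by (simp add: total_mass_def flux_diff_def less_imp_neq[symmetric])
  also have "\<dots> = F (0 + int N) - F 0"
    by (subst sum_lessThan_telescope) simp
  finally show ?thesis using periodic_gridD(1)[OF assms(2), of 0] by simp
qed

lemma total_mass_const_eq:
  assumes "periodic_mesh N L xf"
    and "total_mass N xf (\<lambda>_. a) = total_mass N xf (\<lambda>_. b)"
  shows "a = b"
proof -
  let ?V = "\<Sum>m<N. cell_length xf (int (Suc m))"
  have "N \<ge> 1" using assms(1) by (simp add: periodic_mesh_def)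
  then have "?V > 0"
    using cell_length_pos[OF assms(1)] by (intro sum_pos) (auto simp: lessThan_empty_iff)
  moreover have "?V * a = ?V * b"
    using assms(2) by (simp add: total_mass_def sum_distrib_right)
  ultimately show ?thesis by simp
qed

lemma total_mass_mass_operator:
  assumes mesh: "periodic_mesh N L xf" and D: "D \<in> {D_cen_mass xf, D_upw_mass xf}"
    and per: "periodic_grid N r" "periodic_grid N v"
  shows "total_mass N xf (D r v) = 0"
proof -
  have "periodic_grid N (avg (\<lambda>k. r k * v k))"
    using per by (intro periodic_grid_avg) (simp add: periodic_grid_def)
  moreover have "periodic_grid N
      (\<lambda>k. r k * pos_part (avg v k) + r (k + 1) * neg_part (avg v k))"
    using per periodic_grid_avg[OF per(2)]
    by (simp add: periodic_grid_def[of N "\<lambda>k. _ k + _ k"] periodic_gridD)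
  ultimately show ?thesis
    using D total_mass_flux_diff[OF mesh]
    by (auto simp: D_cen_mass_def D_upw_mass_def D_cen_def)
qed

lemma total_mass_D2_mom:
  assumes mesh: "periodic_mesh N L xf" and per: "periodic_grid N r" "periodic_grid N v"
  shows "total_mass N xf (D2_mom xf r v) = 0"
proof -
  have "periodic_grid N (\<lambda>k. r k * (v k)\<^sup>2)"
    using per by (simp add: periodic_grid_def)
  then show ?thesis
    unfolding D2_mom_def D_cen_def
    by (intro total_mass_flux_diff[OF mesh] periodic_grid_avg periodic_grid_flux_diff[OF mesh])
qed

lemma total_mass_D2_pressure:
  assumes mesh: "periodic_mesh N L xf" and per: "periodic_grid N P"
  shows "total_mass N xf (D2_pressure xf P) = 0"
proof -
  have x: "xf (k + int N) = xf k + L" for k using mesh by (simp add: periodic_mesh_def)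
  have "centre_dist xf (k + int N) = centre_dist xf k" for k
    using x[of "k + 1"] x[of "k - 1"] x[of k]
    by (simp add: centre_dist_def centre_def field_simps)
  then have "periodic_grid N (\<lambda>k. jump P k / centre_dist xf k)"
    using per by (simp add: periodic_grid_def[of N "\<lambda>k. _ k / _ k"] jump_def periodic_gridD)
  then show ?thesis
    unfolding D2_pressure_def by (rule total_mass_flux_diff[OF mesh])
qed

text \<open>A periodic grid function that is harmonic for the three-point Laplacian is constant: its
  interface slopes are all equal, and they sum to zero over a period.\<close>

lemma D2_pressure_eq_0_imp_const:
  assumes mesh: "periodic_mesh N L xf" and per: "periodic_grid N P"
    and zero: "\<And>k. D2_pressure xf P k = 0"
  shows "P k = P l"
proof -
  define G where "G = (\<lambda>k. jump P k / centre_dist xf k)"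
  have step: "G k = G (k - 1)" for k
    using zero[of k] cell_length_pos[OF mesh, of k]
    by (simp add: D2_pressure_def flux_diff_def G_def)
  have G: "G k = G 0" for k
  proof (induction k rule: int_induct[where k = 0])
    case (step1 i) then show ?case using step[of "i + 1"] by simp
  next
    case (step2 i) then show ?case using step[of i] by simp
  qed simp
  have jump: "jump P k = G 0 * centre_dist xf k" for k
    using G[of k] centre_dist_pos[OF mesh, of k] by (simp add: G_def field_simps)
  have "G 0 * centre_dist xf (int m) = P (int (Suc m)) - P (int m)" for m
    using jump[of "int m"] by (simp add: jump_def add.commute)
  then have "G 0 * (\<Sum>m<N. centre_dist xf (int m)) = (\<Sum>m<N. P (int (Suc m)) - P (int m))"
    by (simp only: sum_distrib_left)
  also have "\<dots> = P (0 + int N) - P 0"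
    by (subst sum_lessThan_telescope) simp
  also have "\<dots> = 0" using periodic_gridD(1)[OF per, of 0] by simp
  finally have "G 0 * (\<Sum>m<N. centre_dist xf (int m)) = 0" .
  moreover have "(\<Sum>m<N. centre_dist xf (int m)) > 0"
    using centre_dist_pos[OF mesh] mesh by (intro sum_pos) (auto simp: periodic_mesh_def lessThan_empty_iff)
  ultimately have "G 0 = 0" by simp
  then have P: "P (k + 1) = P k" for k using jump[of k] by (simp add: jump_def)
  have "P k = P 0" for k
  proof (induction k rule: int_induct[where k = 0])
    case (step1 i) then show ?case using P[of i] by simp
  next
    case (step2 i) then show ?case using P[of "i - 1"] by simp
  qed simp
  then show ?thesis by metis
qed

text \<open>The pressure Laplacian and the central difference annihilate constants, so a spatially constant leading part of \<open>P\<close>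
  may be subtracted before dividing by a power of \<open>\<epsilon>\<close>.\<close>

lemma D2_pressure_affine: "D2_pressure xf (\<lambda>k. (P k - a) / e) k = D2_pressure xf P k / e"
  by (simp add: D2_pressure_def flux_diff_def jump_def divide_inverse algebra_simps)

lemma D_cen_eq: "D_cen xf P k = (P (k + 1) - P (k - 1)) / (2 * cell_length xf k)"
  by (simp add: D_cen_def flux_diff_def avg_def diff_divide_distrib[symmetric])

lemma D_cen_affine: "D_cen xf (\<lambda>k. (P k - a) / e) k = D_cen xf P k / e"
  by (simp add: D_cen_eq diff_divide_distrib[symmetric] mult.commute)

section \<open>Continuity of the discrete operators\<close>

text \<open>Convergence of a family of grid functions in every cell as \<open>\<epsilon>\<close> tends to 0 from above.\<close>

definition grid_tendsto :: "(real \<Rightarrow> grid) \<Rightarrow> grid \<Rightarrow> bool" where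
  "grid_tendsto f g \<longleftrightarrow> (\<forall>k. ((\<lambda>\<epsilon>. f \<epsilon> k) \<longlongrightarrow> g k) (at_right 0))"

lemma grid_tendstoD: "grid_tendsto f g \<Longrightarrow> ((\<lambda>\<epsilon>. f \<epsilon> k) \<longlongrightarrow> g k) (at_right 0)"
  by (simp add: grid_tendsto_def)

lemma tendsto_flux_diff:
  "grid_tendsto F G \<Longrightarrow> grid_tendsto (\<lambda>\<epsilon>. flux_diff xf (F \<epsilon>)) (flux_diff xf G)"
  by (cases "\<exists>k. cell_length xf k = 0")
    (auto simp: grid_tendsto_def flux_diff_def divide_inverse intro!: tendsto_intros)

lemma tendsto_avg: "grid_tendsto F G \<Longrightarrow> grid_tendsto (\<lambda>\<epsilon>. avg (F \<epsilon>)) (avg G)"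
  by (auto simp: grid_tendsto_def avg_def intro!: tendsto_intros)

lemma tendsto_D_cen: "grid_tendsto F G \<Longrightarrow> grid_tendsto (\<lambda>\<epsilon>. D_cen xf (F \<epsilon>)) (D_cen xf G)"
  unfolding D_cen_def by (intro tendsto_flux_diff tendsto_avg)

lemma tendsto_D2_pressure:
  "grid_tendsto F G \<Longrightarrow> grid_tendsto (\<lambda>\<epsilon>. D2_pressure xf (F \<epsilon>)) (D2_pressure xf G)"
  unfolding D2_pressure_def
  by (intro tendsto_flux_diff) (auto simp: grid_tendsto_def jump_def divide_inverse intro!: tendsto_intros)

lemma tendsto_D2_mom:
  "grid_tendsto r r' \<Longrightarrow> grid_tendsto v v' \<Longrightarrow>
    grid_tendsto (\<lambda>\<epsilon>. D2_mom xf (r \<epsilon>) (v \<epsilon>)) (D2_mom xf r' v')"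
  unfolding D2_mom_def
  by (intro tendsto_D_cen) (auto simp: grid_tendsto_def intro!: tendsto_intros)

lemma tendsto_pos_part: "(f \<longlongrightarrow> a) F \<Longrightarrow> ((\<lambda>x. pos_part (f x)) \<longlongrightarrow> pos_part a) F"
  unfolding pos_part_def by (intro tendsto_intros) auto

lemma tendsto_neg_part: "(f \<longlongrightarrow> a) F \<Longrightarrow> ((\<lambda>x. neg_part (f x)) \<longlongrightarrow> neg_part a) F"
  unfolding neg_part_def by (intro tendsto_intros) auto

lemma tendsto_mass_operator:
  assumes D: "D \<in> {D_cen_mass xf, D_upw_mass xf}"
    and r: "grid_tendsto r r'" and v: "grid_tendsto v v'"
  shows "grid_tendsto (\<lambda>\<epsilon>. D (r \<epsilon>) (v \<epsilon>)) (D r' v')"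
proof -
  have "grid_tendsto (\<lambda>\<epsilon>. D_cen_mass xf (r \<epsilon>) (v \<epsilon>)) (D_cen_mass xf r' v')"
    unfolding D_cen_mass_def using r v
    by (intro tendsto_D_cen) (auto simp: grid_tendsto_def intro!: tendsto_intros)
  moreover have "grid_tendsto (\<lambda>\<epsilon>. D_upw_mass xf (r \<epsilon>) (v \<epsilon>)) (D_upw_mass xf r' v')"
    unfolding D_upw_mass_def using r tendsto_avg[OF v]
    by (intro tendsto_flux_diff)
      (auto simp: grid_tendsto_def intro!: tendsto_intros tendsto_pos_part tendsto_neg_part)
  ultimately show ?thesis using D by auto
qed

text \<open>The case distinction in the min-mod function hides its continuity; this form shows it.\<close>

lemma minmod_eq_max_min: "minmod a b = max 0 (min a b) + min 0 (max a b)"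
  by (auto simp: minmod_def max_def min_def abs_if zero_less_mult_iff)

lemma tendsto_jump: "grid_tendsto v v' \<Longrightarrow> grid_tendsto (\<lambda>\<epsilon>. jump (v \<epsilon>)) (jump v')"
  by (auto simp: grid_tendsto_def jump_def intro!: tendsto_intros)

lemma tendsto_reconstructed_jump:
  "grid_tendsto v v' \<Longrightarrow> grid_tendsto (\<lambda>\<epsilon>. reconstructed_jump (v \<epsilon>)) (reconstructed_jump v')"
  unfolding grid_tendsto_def reconstructed_jump_def slope_def minmod_eq_max_min
  by (auto intro!: tendsto_intros tendsto_max tendsto_min)

text \<open>By Cauchy's mean value theorem, applied to the powers with exponents \<open>\<gamma>\<close> and \<open>\<gamma> - 1\<close>, the
  density mean of the entropy stable flux lies between its two arguments.  Hence it tends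
  to \<open>R\<close> whenever both densities do.\<close>

lemma gamma_mean_between:
  assumes "\<gamma> > 1" "r k > 0" "r (k + 1) > 0"
  shows "min (r k) (r (k + 1)) \<le> gamma_mean \<gamma> r k" "gamma_mean \<gamma> r k \<le> max (r k) (r (k + 1))"
proof -
  have mean: "\<exists>z. a < z \<and> z < b \<and>
      (\<gamma> - 1) / \<gamma> * ((b powr \<gamma> - a powr \<gamma>) / (b powr (\<gamma> - 1) - a powr (\<gamma> - 1))) = z"
    if ab: "0 < a" "a < b" for a b :: real
  proof -
    have "\<exists>z. a < z \<and> z < b \<and> (b powr \<gamma> - a powr \<gamma>) * ((\<gamma> - 1) * z powr (\<gamma> - 1 - 1)) =
        (b powr (\<gamma> - 1) - a powr (\<gamma> - 1)) * (\<gamma> * z powr (\<gamma> - 1))"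
      using ab assms(1)
      by (intro GMVT' has_real_derivative_powr continuous_intros) auto
    then obtain z where z: "a < z" "z < b"
      and eq: "(b powr \<gamma> - a powr \<gamma>) * ((\<gamma> - 1) * z powr (\<gamma> - 1 - 1)) =
        (b powr (\<gamma> - 1) - a powr (\<gamma> - 1)) * (\<gamma> * z powr (\<gamma> - 1))" by blast
    have "z powr (\<gamma> - 1) = z * z powr (\<gamma> - 1 - 1)" "z powr (\<gamma> - 1 - 1) > 0"
      using z ab by (simp_all add: powr_mult_base)
    with eq have "(b powr \<gamma> - a powr \<gamma>) * (\<gamma> - 1) = (b powr (\<gamma> - 1) - a powr (\<gamma> - 1)) * (\<gamma> * z)"
      by simp
    moreover have "a powr (\<gamma> - 1) < b powr (\<gamma> - 1)"
      using ab assms(1) by (intro powr_less_mono2) auto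
    ultimately have "(\<gamma> - 1) / \<gamma> * ((b powr \<gamma> - a powr \<gamma>) / (b powr (\<gamma> - 1) - a powr (\<gamma> - 1))) = z"
      using assms(1) by (simp add: field_simps)
    with z show ?thesis by blast
  qed
  have swap: "(b - a) / (d - c) = (a - b) / (c - d)" for a b c d :: real
    by (metis minus_diff_eq minus_divide_divide)
  have "min (r k) (r (k + 1)) \<le> gamma_mean \<gamma> r k \<and> gamma_mean \<gamma> r k \<le> max (r k) (r (k + 1))"
  proof (cases "r k" "r (k + 1)" rule: linorder_cases)
    case less
    from mean[OF assms(2) less] less show ?thesis by (auto simp: gamma_mean_def jump_def)
  next
    case equal then show ?thesis by (simp add: gamma_mean_def)
  next
    case greater
    from mean[OF assms(3) greater] greater show ?thesis
      by (auto simp: gamma_mean_def jump_def swap[of "r (k + 1) powr \<gamma>"])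
  qed
  then show "min (r k) (r (k + 1)) \<le> gamma_mean \<gamma> r k" "gamma_mean \<gamma> r k \<le> max (r k) (r (k + 1))"
    by auto
qed

lemma tendsto_gamma_mean:
  assumes "\<gamma> > 1" "R > 0" and r: "grid_tendsto r (\<lambda>_. R)"
  shows "grid_tendsto (\<lambda>\<epsilon>. gamma_mean \<gamma> (r \<epsilon>)) (\<lambda>_. R)"
  unfolding grid_tendsto_def
proof
  fix k
  have lim: "((\<lambda>\<epsilon>. r \<epsilon> k) \<longlongrightarrow> R) (at_right 0)" "((\<lambda>\<epsilon>. r \<epsilon> (k + 1)) \<longlongrightarrow> R) (at_right 0)"
    using r by (simp_all add: grid_tendsto_def)
  have pos: "\<forall>\<^sub>F \<epsilon> in at_right 0. r \<epsilon> k > 0 \<and> r \<epsilon> (k + 1) > 0"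
    using order_tendstoD(1)[OF lim(1) assms(2)] order_tendstoD(1)[OF lim(2) assms(2)]
    by eventually_elim simp
  show "((\<lambda>\<epsilon>. gamma_mean \<gamma> (r \<epsilon>) k) \<longlongrightarrow> R) (at_right 0)"
  proof (rule tendsto_sandwich)
    show "\<forall>\<^sub>F \<epsilon> in at_right 0. min (r \<epsilon> k) (r \<epsilon> (k + 1)) \<le> gamma_mean \<gamma> (r \<epsilon>) k"
      using pos by eventually_elim (simp add: gamma_mean_between[OF assms(1)])
    show "\<forall>\<^sub>F \<epsilon> in at_right 0. gamma_mean \<gamma> (r \<epsilon>) k \<le> max (r \<epsilon> k) (r \<epsilon> (k + 1))"
      using pos by eventually_elim (simp add: gamma_mean_between[OF assms(1)])
  qed (use tendsto_min[OF lim] tendsto_max[OF lim] in simp_all)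
qed

lemma tendsto_momentum_operator:
  assumes D1: "D1 \<in> {D_upw_mom xf, D_ES_mom jump \<gamma> q xf, D_ES_mom reconstructed_jump \<gamma> q xf}"
    and "\<gamma> > 1" "R > 0" and r: "grid_tendsto r (\<lambda>_. R)" and v: "grid_tendsto v v'"
  shows "grid_tendsto (\<lambda>\<epsilon>. D1 (r \<epsilon>) (v \<epsilon>)) (D1 (\<lambda>_. R) v')"
proof -
  have "grid_tendsto (\<lambda>\<epsilon>. D_upw_mom xf (r \<epsilon>) (v \<epsilon>)) (D_upw_mom xf (\<lambda>_. R) v')"
    unfolding D_upw_mom_def using r v tendsto_avg[OF v]
    by (intro tendsto_flux_diff)
      (auto simp: grid_tendsto_def intro!: tendsto_intros tendsto_pos_part tendsto_neg_part)
  moreover have "grid_tendsto (\<lambda>\<epsilon>. D_ES_mom J \<gamma> q xf (r \<epsilon>) (v \<epsilon>)) (D_ES_mom J \<gamma> q xf (\<lambda>_. R) v')"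
    if J: "grid_tendsto (\<lambda>\<epsilon>. J (v \<epsilon>)) (J v')" for J
  proof -
    have "gamma_mean \<gamma> (\<lambda>_. R) = (\<lambda>_. R)" by (auto simp: gamma_mean_def)
    then show ?thesis
      unfolding D_ES_mom_def using J tendsto_gamma_mean[OF assms(2,3) r] tendsto_avg[OF v]
      by (intro tendsto_flux_diff) (auto simp: grid_tendsto_def intro!: tendsto_intros)
  qed
  ultimately show ?thesis
    using D1 tendsto_jump[OF v] tendsto_reconstructed_jump[OF v] by auto
qed

section \<open>One time step\<close>

text \<open>The stage equations conserve mass, since every operator in them is a difference of
  periodic fluxes.\<close>

lemma total_mass_density_rhs:
  assumes mesh: "periodic_mesh N L xf" and D: "D \<in> {D_cen_mass xf, D_upw_mass xf}"
    and n: "periodic_grid N \<rho>n" "periodic_grid N un"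
    and s: "\<And>j. j \<in> {1..i} \<Longrightarrow> periodic_grid N (\<rho>s j)" "\<And>j. j \<in> {1..i} \<Longrightarrow> periodic_grid N (us j)"
  shows "total_mass N xf (density_rhs xf At A D p dt \<epsilon> \<rho>n un \<rho>s us i) = total_mass N xf \<rho>n"
proof -
  have "total_mass N xf (density_rhs xf At A D p dt \<epsilon> \<rho>n un \<rho>s us i) =
      total_mass N xf \<rho>n
      - dt * (\<Sum>j=1..<i. A i j * total_mass N xf (D (\<rho>s j) (us j)))
      - dt * A i i * total_mass N xf (D \<rho>n un)
      + dt\<^sup>2 * A i i * (\<Sum>j=1..<i. At i j * total_mass N xf (D2_mom xf (\<rho>s j) (us j)))
      + dt\<^sup>2 / \<epsilon>\<^sup>2 * A i i *
          (\<Sum>j=1..i. A i j * total_mass N xf (D2_pressure xf (\<lambda>l. p (\<rho>s j l))))"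
    unfolding density_rhs_def by (simp only: total_mass_linear)
  moreover have "total_mass N xf (D2_pressure xf (\<lambda>l. p (\<rho>s j l))) = 0" if "j \<in> {1..i}" for j
    using s(1)[OF that] by (intro total_mass_D2_pressure[OF mesh]) (simp add: periodic_grid_def)
  ultimately show ?thesis
    using s n total_mass_mass_operator[OF mesh D] total_mass_D2_mom[OF mesh] by simp
qed

text \<open>The density equation forces the discrete Laplacian of the stage pressures to be \<open>o(\<epsilon>)\<close>:
  multiplied by \<open>\<epsilon>\<close>, all its terms but the pressure term tend to zero, and the resulting
  triangular system in the stages has non-zero diagonal.\<close>

lemma stage_pressure_laplacian_tendsto:
  fixes \<rho>n un :: "real \<Rightarrow> grid" and \<rho>s us :: "nat \<Rightarrow> real \<Rightarrow> grid"
  assumes D: "D \<in> {D_cen_mass xf, D_upw_mass xf}" and dt: "dt \<noteq> 0"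
    and A: "\<And>i. i \<in> {1..s} \<Longrightarrow> A i i \<noteq> 0"
    and n: "grid_tendsto \<rho>n \<rho>n'" "grid_tendsto un un'"
    and st: "\<And>j. j \<in> {1..s} \<Longrightarrow> grid_tendsto (\<rho>s j) (\<rho>s' j)"
      "\<And>j. j \<in> {1..s} \<Longrightarrow> grid_tendsto (us j) (us' j)"
    and eq: "\<And>i k. i \<in> {1..s} \<Longrightarrow> formally_equal (\<lambda>\<epsilon>. \<rho>s i \<epsilon> k)
        (\<lambda>\<epsilon>. density_rhs xf At A D p dt \<epsilon> (\<rho>n \<epsilon>) (un \<epsilon>) (\<lambda>j. \<rho>s j \<epsilon>) (\<lambda>j. us j \<epsilon>) i k)"
    and "i \<in> {1..s}"
  shows "((\<lambda>\<epsilon>. D2_pressure xf (\<lambda>l. p (\<rho>s i \<epsilon> l)) k / \<epsilon>) \<longlongrightarrow> 0) (at_right 0)"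
  using \<open>i \<in> {1..s}\<close>
proof (induction i rule: less_induct)
  case (less i)
  \<comment> \<open>\<open>B\<close> collects the terms of the right-hand side that stay bounded, \<open>R\<close> is the residual.\<close>
  define E where "E = (\<lambda>j \<epsilon>. D2_pressure xf (\<lambda>l. p (\<rho>s j \<epsilon> l)) k)"
  define B where "B = (\<lambda>\<epsilon>. \<rho>n \<epsilon> k - dt * (\<Sum>j=1..<i. A i j * D (\<rho>s j \<epsilon>) (us j \<epsilon>) k)
     - dt * A i i * D (\<rho>n \<epsilon>) (un \<epsilon>) k
     + dt\<^sup>2 * A i i * (\<Sum>j=1..<i. At i j * D2_mom xf (\<rho>s j \<epsilon>) (us j \<epsilon>) k))"
  define R where "R = (\<lambda>\<epsilon>. \<rho>s i \<epsilon> k -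
     density_rhs xf At A D p dt \<epsilon> (\<rho>n \<epsilon>) (un \<epsilon>) (\<lambda>j. \<rho>s j \<epsilon>) (\<lambda>j. us j \<epsilon>) i k)"
  have before: "j \<in> {1..s}" if "j \<in> {1..<i}" for j using that less.prems by auto
  have eps: "((\<lambda>\<epsilon>. \<epsilon>) \<longlongrightarrow> (0::real)) (at_right 0)" by (rule tendsto_ident_at)
  have R: "(R \<longlongrightarrow> 0) (at_right 0)"
    unfolding R_def by (rule formally_equal_tendsto_0[OF eq[OF less.prems]])
  define b where "b = \<rho>n' k - dt * (\<Sum>j=1..<i. A i j * D (\<rho>s' j) (us' j) k)
     - dt * A i i * D \<rho>n' un' k
     + dt\<^sup>2 * A i i * (\<Sum>j=1..<i. At i j * D2_mom xf (\<rho>s' j) (us' j) k)"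
  have B: "(B \<longlongrightarrow> b) (at_right 0)"
    unfolding B_def b_def
    by (intro tendsto_intros n[THEN grid_tendstoD]
        tendsto_mass_operator[OF D, THEN grid_tendstoD] tendsto_D2_mom[THEN grid_tendstoD]
        n st before)
  have "((\<lambda>\<epsilon>. \<epsilon> * (\<rho>s i \<epsilon> k - B \<epsilon> - R \<epsilon>)) \<longlongrightarrow> 0 * (\<rho>s' i k - b - 0)) (at_right 0)"
    by (intro tendsto_intros eps B R st(1)[OF less.prems, THEN grid_tendstoD])
  moreover have "\<forall>\<^sub>F \<epsilon> in at_right 0. \<epsilon> * (\<rho>s i \<epsilon> k - B \<epsilon> - R \<epsilon>) =
      dt\<^sup>2 * A i i * (\<Sum>j=1..i. A i j * (E j \<epsilon> / \<epsilon>))"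
    using eventually_at_right_less[of "0::real"]
  proof eventually_elim
    case (elim \<epsilon>)
    have "\<rho>s i \<epsilon> k - B \<epsilon> - R \<epsilon> = dt\<^sup>2 / \<epsilon>\<^sup>2 * A i i * (\<Sum>j=1..i. A i j * E j \<epsilon>)"
      by (simp add: R_def B_def density_rhs_def E_def)
    then show ?case
      using elim by (simp add: sum_divide_distrib[symmetric] power2_eq_square)
  qed
  ultimately have "((\<lambda>\<epsilon>. dt\<^sup>2 * A i i * (\<Sum>j=1..i. A i j * (E j \<epsilon> / \<epsilon>))) \<longlongrightarrow> 0) (at_right 0)"
    using Lim_transform_eventually by fastforce
  from tendsto_mult_left[OF this, of "1 / (dt\<^sup>2 * A i i)"]
  have sum: "((\<lambda>\<epsilon>. \<Sum>j=1..i. A i j * (E j \<epsilon> / \<epsilon>)) \<longlongrightarrow> 0) (at_right 0)"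
    using dt A[OF less.prems] by simp
  have "((\<lambda>\<epsilon>. \<Sum>j=1..<i. A i j * (E j \<epsilon> / \<epsilon>)) \<longlongrightarrow> (\<Sum>j=1..<i. A i j * 0)) (at_right 0)"
    unfolding E_def using before by (intro tendsto_intros less.IH) auto
  from tendsto_diff[OF sum this]
  have "((\<lambda>\<epsilon>. A i i * (E i \<epsilon> / \<epsilon>)) \<longlongrightarrow> 0) (at_right 0)"
    using less.prems by (simp add: sum.last_plus)
  from tendsto_mult_left[OF this, of "1 / A i i"]
  show ?case using A[OF less.prems] by (simp add: E_def)
qed

section \<open>Coefficients of density and pressure\<close>

lemma periodic_coeffs:
  assumes "\<forall>\<^sub>F \<epsilon> in at_right 0. periodic_grid N (f \<epsilon>)"
    and "\<And>k. has_expansion (\<lambda>\<epsilon>. f \<epsilon> k) (\<lambda>m. c m k)"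
  shows "periodic_grid N (c m)"
  unfolding periodic_grid_def
proof
  fix k
  have "\<forall>\<^sub>F \<epsilon> in at_right 0. f \<epsilon> (k + int N) = f \<epsilon> k"
    using assms(1) by eventually_elim (simp add: periodic_grid_def)
  from eventually_eq_imp_coeffs_eq[OF this assms(2,2)] show "c m (k + int N) = c m k" .
qed

text \<open>An \<open>o(\<epsilon>)\<close> Laplacian annihilates the coefficients of order 0 and 1 of its argument.\<close>

lemma pressure_coeffs_const:
  assumes mesh: "periodic_mesh N L xf"
    and per: "\<forall>\<^sub>F \<epsilon> in at_right 0. periodic_grid N (P \<epsilon>)"
    and P: "\<And>k. has_expansion (\<lambda>\<epsilon>. P \<epsilon> k) (\<lambda>m. c m k)"
    and lap: "\<And>k. ((\<lambda>\<epsilon>. D2_pressure xf (P \<epsilon>) k / \<epsilon>) \<longlongrightarrow> 0) (at_right 0)"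
  shows "c 0 k = c 0 l" "c 1 k = c 1 l"
proof -
  have eps: "((\<lambda>\<epsilon>. \<epsilon>) \<longlongrightarrow> (0::real)) (at_right 0)" by (rule tendsto_ident_at)
  have "D2_pressure xf (c 0) k = 0" for k
  proof (rule tendsto_unique)
    show "((\<lambda>\<epsilon>. D2_pressure xf (P \<epsilon>) k) \<longlongrightarrow> D2_pressure xf (c 0) k) (at_right 0)"
      by (rule grid_tendstoD[OF tendsto_D2_pressure])
        (simp add: grid_tendsto_def has_expansion_tendsto_0[OF P])
    show "((\<lambda>\<epsilon>. D2_pressure xf (P \<epsilon>) k) \<longlongrightarrow> 0) (at_right 0)"
      by (rule Lim_transform_eventually[OF tendsto_mult_zero[OF eps lap[of k]]])
        (use eventually_at_right_less[of "0::real"] in eventually_elim, simp)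
  qed simp
  then have c0: "c 0 k = c 0 l" for k l
    using D2_pressure_eq_0_imp_const[OF mesh periodic_coeffs[OF per P]] by blast
  then show "c 0 k = c 0 l" .
  have "((\<lambda>\<epsilon>. (P \<epsilon> k - c 0 0) / \<epsilon>) \<longlongrightarrow> c 1 k) (at_right 0)" for k
    using has_expansion_tendsto_1[OF P] by (simp add: c0[of 0 k])
  then have "grid_tendsto (\<lambda>\<epsilon> k. (P \<epsilon> k - c 0 0) / \<epsilon>) (c 1)"
    by (simp add: grid_tendsto_def)
  from grid_tendstoD[OF tendsto_D2_pressure[OF this]]
  have "((\<lambda>\<epsilon>. D2_pressure xf (P \<epsilon>) k / \<epsilon>) \<longlongrightarrow> D2_pressure xf (c 1) k) (at_right 0)" for k
    by (simp add: D2_pressure_affine)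
  from tendsto_unique[OF _ this lap] have "D2_pressure xf (c 1) k = 0" for k by simp
  then show "c 1 k = c 1 l"
    using D2_pressure_eq_0_imp_const[OF mesh periodic_coeffs[OF per P]] by blast
qed

text \<open>Positivity of \<open>f\<close> only yields \<open>r 0 \<ge> 0\<close> in the limit; that is enough here, since \<open>x powr \<gamma>\<close>
  is continuous at 0 from the right for positive \<open>\<gamma>\<close>.\<close>

lemma pressure_coeff_0:
  assumes "\<gamma> > 1" and r: "has_expansion f r" and p: "has_expansion (\<lambda>\<epsilon>. pressure \<kappa> \<gamma> (f \<epsilon>)) p"
    and pos: "\<forall>\<^sub>F \<epsilon> in at_right 0. f \<epsilon> > 0"
  shows "r 0 \<ge> 0" "p 0 = \<kappa> * r 0 powr \<gamma>"
proof -
  have nonneg: "\<forall>\<^sub>F \<epsilon> in at_right 0. 0 \<le> f \<epsilon>"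
    using pos by eventually_elim simp
  show "r 0 \<ge> 0"
    by (rule tendsto_lowerbound[OF has_expansion_tendsto_0[OF r] nonneg]) simp
  have "((\<lambda>\<epsilon>. pressure \<kappa> \<gamma> (f \<epsilon>)) \<longlongrightarrow> \<kappa> * r 0 powr \<gamma>) (at_right 0)"
    unfolding pressure_def using assms(1)
    by (intro tendsto_intros tendsto_powr2 has_expansion_tendsto_0[OF r] nonneg) simp
  from tendsto_unique[OF _ has_expansion_tendsto_0[OF p] this]
  show "p 0 = \<kappa> * r 0 powr \<gamma>" by simp
qed

lemma pressure_coeff_1:
  assumes r: "has_expansion f r" and p: "has_expansion (\<lambda>\<epsilon>. pressure \<kappa> \<gamma> (f \<epsilon>)) p"
    and r0: "r 0 > 0"
  shows "p 1 = \<kappa> * \<gamma> * r 0 powr (\<gamma> - 1) * r 1"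
proof -
  have der: "(pressure \<kappa> \<gamma> has_real_derivative \<kappa> * (\<gamma> * r 0 powr (\<gamma> - 1))) (at (r 0))"
    unfolding pressure_def using r0
    by (intro DERIV_cmult has_real_derivative_powr)
  from DERIV_isCont[OF this] has_expansion_tendsto_0[OF r]
  have "((\<lambda>\<epsilon>. pressure \<kappa> \<gamma> (f \<epsilon>)) \<longlongrightarrow> pressure \<kappa> \<gamma> (r 0)) (at_right 0)"
    by (rule isCont_tendsto_compose)
  from tendsto_unique[OF _ has_expansion_tendsto_0[OF p] this]
  have p0: "p 0 = pressure \<kappa> \<gamma> (r 0)" by simp
  from difference_quotient_compose_tendsto[OF has_expansion_tendsto_1[OF r] der]
  have "((\<lambda>\<epsilon>. (pressure \<kappa> \<gamma> (f \<epsilon>) - p 0) / \<epsilon>) \<longlongrightarrow>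
      \<kappa> * (\<gamma> * r 0 powr (\<gamma> - 1)) * r 1) (at_right 0)"
    by (simp add: p0)
  from tendsto_unique[OF _ has_expansion_tendsto_1[OF p] this] show ?thesis by simp
qed

text \<open>A single time step: data \<open>\<rho>n\<close>, \<open>un\<close> at the old time level and stages \<open>\<rho>s\<close>, \<open>us\<close> with
  asymptotic expansions (a final \<open>c\<close> marks the coefficients, indexed by order and cell; \<open>psc\<close>
  are those of the stage pressures), which satisfy the stage equations formally.  The density
  at the old time level is constant in space up to first order in \<open>\<epsilon>\<close>, with coefficients \<open>R\<close> and \<open>R1\<close>.\<close>

locale expanded_time_step =
  fixes N s :: nat and L \<kappa> \<gamma> q dt R R1 :: real and xf :: grid
    and At A :: "nat \<Rightarrow> nat \<Rightarrow> real" and D D1 :: "grid \<Rightarrow> grid \<Rightarrow> grid"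
    and \<rho>n un :: "real \<Rightarrow> grid" and \<rho>s us :: "nat \<Rightarrow> real \<Rightarrow> grid"
    and \<rho>nc unc :: "nat \<Rightarrow> grid" and \<rho>sc usc psc :: "nat \<Rightarrow> nat \<Rightarrow> grid"
  assumes constants: "\<kappa> > 0" "\<gamma> > 1" "R > 0" "dt > 0"
    and mesh: "periodic_mesh N L xf"
    and A: "\<And>i. i \<in> {1..s} \<Longrightarrow> A i i \<noteq> 0"
    and D: "D \<in> {D_cen_mass xf, D_upw_mass xf}"
    and D1: "D1 \<in> {D_upw_mom xf, D_ES_mom jump \<gamma> q xf, D_ES_mom reconstructed_jump \<gamma> q xf}"
    and periodic_n: "\<forall>\<^sub>F \<epsilon> in at_right 0. periodic_grid N (\<rho>n \<epsilon>) \<and> periodic_grid N (un \<epsilon>)"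
    and periodic_s: "\<And>i. i \<in> {1..s} \<Longrightarrow>
      \<forall>\<^sub>F \<epsilon> in at_right 0. periodic_grid N (\<rho>s i \<epsilon>) \<and> periodic_grid N (us i \<epsilon>)"
    and positive: "\<And>i. i \<in> {1..s} \<Longrightarrow> \<forall>\<^sub>F \<epsilon> in at_right 0. \<forall>k. \<rho>s i \<epsilon> k > 0"
    and exp_n: "\<And>k. has_expansion (\<lambda>\<epsilon>. \<rho>n \<epsilon> k) (\<lambda>m. \<rho>nc m k)"
      "\<And>k. has_expansion (\<lambda>\<epsilon>. un \<epsilon> k) (\<lambda>m. unc m k)"
    and exp_s: "\<And>i k. i \<in> {1..s} \<Longrightarrow> has_expansion (\<lambda>\<epsilon>. \<rho>s i \<epsilon> k) (\<lambda>m. \<rho>sc i m k)"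
      "\<And>i k. i \<in> {1..s} \<Longrightarrow> has_expansion (\<lambda>\<epsilon>. us i \<epsilon> k) (\<lambda>m. usc i m k)"
      "\<And>i k. i \<in> {1..s} \<Longrightarrow>
        has_expansion (\<lambda>\<epsilon>. pressure \<kappa> \<gamma> (\<rho>s i \<epsilon> k)) (\<lambda>m. psc i m k)"
    and density_eq: "\<And>i k. i \<in> {1..s} \<Longrightarrow> formally_equal (\<lambda>\<epsilon>. \<rho>s i \<epsilon> k)
      (\<lambda>\<epsilon>. density_rhs xf At A D (pressure \<kappa> \<gamma>) dt \<epsilon>
        (\<rho>n \<epsilon>) (un \<epsilon>) (\<lambda>j. \<rho>s j \<epsilon>) (\<lambda>j. us j \<epsilon>) i k)"
    and momentum_eq: "\<And>i k. i \<in> {1..s} \<Longrightarrow> formally_equal (\<lambda>\<epsilon>. \<rho>s i \<epsilon> k * us i \<epsilon> k)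
      (\<lambda>\<epsilon>. momentum_rhs xf At A D1 (pressure \<kappa> \<gamma>) dt \<epsilon>
        (\<rho>n \<epsilon>) (un \<epsilon>) (\<lambda>j. \<rho>s j \<epsilon>) (\<lambda>j. us j \<epsilon>) i k)"
    and \<rho>nc_0: "\<And>k. \<rho>nc 0 k = R" and \<rho>nc_1: "\<And>k. \<rho>nc 1 k = R1"
begin

lemma grid_limits:
  "grid_tendsto \<rho>n (\<rho>nc 0)" "grid_tendsto un (unc 0)"
  "\<And>i. i \<in> {1..s} \<Longrightarrow> grid_tendsto (\<rho>s i) (\<rho>sc i 0)"
  "\<And>i. i \<in> {1..s} \<Longrightarrow> grid_tendsto (us i) (usc i 0)"
  unfolding grid_tendsto_def using exp_n exp_s has_expansion_tendsto_0 by blast+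

text \<open>Mass is conserved separately at every order of \<open>\<epsilon>\<close>.\<close>

lemma total_mass_coeffs:
  assumes "i \<in> {1..s}"
  shows "total_mass N xf (\<rho>sc i m) = total_mass N xf (\<rho>nc m)"
proof (rule formally_equal_imp_coeffs_eq)
  let ?rhs = "\<lambda>\<epsilon>. density_rhs xf At A D (pressure \<kappa> \<gamma>) dt \<epsilon>
        (\<rho>n \<epsilon>) (un \<epsilon>) (\<lambda>j. \<rho>s j \<epsilon>) (\<lambda>j. us j \<epsilon>) i"
  have "\<forall>\<^sub>F \<epsilon> in at_right 0. \<forall>j\<in>{1..i}. periodic_grid N (\<rho>s j \<epsilon>) \<and> periodic_grid N (us j \<epsilon>)"
    using assms periodic_s by (intro eventually_ball_finite) auto
  with periodic_n have "\<forall>\<^sub>F \<epsilon> in at_right 0. total_mass N xf (?rhs \<epsilon>) = total_mass N xf (\<rho>n \<epsilon>)"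
    by eventually_elim (intro total_mass_density_rhs[OF mesh D], auto)
  from formally_equalI[OF this]
  have "formally_equal (\<lambda>\<epsilon>. total_mass N xf (?rhs \<epsilon>)) (\<lambda>\<epsilon>. total_mass N xf (\<rho>n \<epsilon>))" .
  moreover have "formally_equal (\<lambda>\<epsilon>. total_mass N xf (\<rho>s i \<epsilon>)) (\<lambda>\<epsilon>. total_mass N xf (?rhs \<epsilon>))"
    unfolding total_mass_def by (intro formally_equal_weighted_sum density_eq assms)
  ultimately show
    "formally_equal (\<lambda>\<epsilon>. total_mass N xf (\<rho>s i \<epsilon>)) (\<lambda>\<epsilon>. total_mass N xf (\<rho>n \<epsilon>))"
    by (rule formally_equal_trans[rotated])
  show "has_expansion (\<lambda>\<epsilon>. total_mass N xf (\<rho>s i \<epsilon>)) (\<lambda>m. total_mass N xf (\<rho>sc i m))"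
    unfolding total_mass_def by (intro has_expansion_weighted_sum exp_s assms)
  show "has_expansion (\<lambda>\<epsilon>. total_mass N xf (\<rho>n \<epsilon>)) (\<lambda>m. total_mass N xf (\<rho>nc m))"
    unfolding total_mass_def by (intro has_expansion_weighted_sum exp_n)
qed

text \<open>The first consequence of the scheme: \<open>p\<^sub>(\<^sub>0\<^sub>)\<close> and \<open>p\<^sub>(\<^sub>1\<^sub>)\<close> are constant in space.\<close>

lemma psc_const:
  assumes i: "i \<in> {1..s}"
  shows "psc i 0 k = psc i 0 l" "psc i 1 k = psc i 1 l"
proof -
  have per: "\<forall>\<^sub>F \<epsilon> in at_right 0. periodic_grid N (\<lambda>k. pressure \<kappa> \<gamma> (\<rho>s i \<epsilon> k))"
    using periodic_s[OF i] by eventually_elim (simp add: periodic_grid_def)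
  have "((\<lambda>\<epsilon>. D2_pressure xf (\<lambda>k. pressure \<kappa> \<gamma> (\<rho>s i \<epsilon> k)) k / \<epsilon>) \<longlongrightarrow> 0) (at_right 0)" for k
    using D _ A grid_limits density_eq i
    by (rule stage_pressure_laplacian_tendsto) (use constants in simp)
  note pressure_coeffs_const[OF mesh per exp_s(3)[OF i] this]
  then show "psc i 0 k = psc i 0 l" "psc i 1 k = psc i 1 l" by blast+
qed

lemma stage_positive: "i \<in> {1..s} \<Longrightarrow> \<forall>\<^sub>F \<epsilon> in at_right 0. \<rho>s i \<epsilon> k > 0"
  using positive[of i] by (auto elim: eventually_mono)

text \<open>Injectivity of the pressure law makes \<open>\<rho>\<^sub>(\<^sub>0\<^sub>)\<close> constant in space; conservation of mass then
  identifies the constant.  The same argument with the derivative of the pressure law works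
  at first order.\<close>

lemma \<rho>sc_0:
  assumes i: "i \<in> {1..s}"
  shows "\<rho>sc i 0 k = R"
proof -
  note p0 = pressure_coeff_0[OF constants(2) exp_s(1,3)[OF i] stage_positive[OF i]]
  have const: "\<rho>sc i 0 k = \<rho>sc i 0 l" for k l
  proof -
    have "\<rho>sc i 0 k powr \<gamma> = \<rho>sc i 0 l powr \<gamma>"
      using psc_const(1)[OF i, of k l] constants by (simp add: p0)
    then show ?thesis
      using p0(1)[of k] p0(1)[of l] constants(2)
      by (metis less_irrefl linorder_cases powr_less_mono2 less_trans zero_less_one)
  qed
  then obtain C where C: "\<And>k. \<rho>sc i 0 k = C" by metis
  have "total_mass N xf (\<lambda>_. C) = total_mass N xf (\<lambda>_. R)"
    using total_mass_coeffs[OF i, of 0] by (simp add: total_mass_def C \<rho>nc_0 del: One_nat_def)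
  then show ?thesis using total_mass_const_eq[OF mesh] C by simp
qed

lemma \<rho>sc_1:
  assumes i: "i \<in> {1..s}"
  shows "\<rho>sc i 1 k = R1"
proof -
  have "psc i 1 k = \<kappa> * \<gamma> * R powr (\<gamma> - 1) * \<rho>sc i 1 k" for k
    using pressure_coeff_1[OF exp_s(1,3)[OF i]] constants \<rho>sc_0[OF i] by simp
  then have const: "\<rho>sc i 1 k = \<rho>sc i 1 l" for k l
    using psc_const(2)[OF i, of k l] constants by simp
  then obtain C where C: "\<And>k. \<rho>sc i 1 k = C" by metis
  have "total_mass N xf (\<lambda>_. C) = total_mass N xf (\<lambda>_. R1)"
    using total_mass_coeffs[OF i, of 1] by (simp add: total_mass_def C \<rho>nc_1 del: One_nat_def)
  then show ?thesis using total_mass_const_eq[OF mesh] C by simp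
qed

lemma pressure_gradient_tendsto:
  assumes i: "i \<in> {1..s}"
  shows "((\<lambda>\<epsilon>. D_cen xf (\<lambda>l. pressure \<kappa> \<gamma> (\<rho>s i \<epsilon> l)) k / \<epsilon>\<^sup>2) \<longlongrightarrow> D_cen xf (psc i 2) k)
    (at_right 0)"
proof -
  have "((\<lambda>\<epsilon>. (pressure \<kappa> \<gamma> (\<rho>s i \<epsilon> l) - (psc i 0 0 + psc i 1 0 * \<epsilon>)) / \<epsilon>\<^sup>2) \<longlongrightarrow> psc i 2 l)
      (at_right 0)" for l
    using has_expansion_tendsto_2[OF exp_s(3)[OF i]] psc_const[OF i, of 0 l] by simp
  then have "grid_tendsto
      (\<lambda>\<epsilon> l. (pressure \<kappa> \<gamma> (\<rho>s i \<epsilon> l) - (psc i 0 0 + psc i 1 0 * \<epsilon>)) / \<epsilon>\<^sup>2) (psc i 2)"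
    by (simp add: grid_tendsto_def)
  from grid_tendstoD[OF tendsto_D_cen[OF this, of xf], of k]
  show ?thesis by (simp add: D_cen_affine)
qed

text \<open>The momentum equation at order 0, divided by the constant density \<open>R\<close>.\<close>

lemma usc_0:
  assumes i: "i \<in> {1..s}"
  shows "usc i 0 k = unc 0 k - dt * (\<Sum>j=1..<i. At i j * (D1 (\<lambda>_. R) (usc j 0) k / R))
    - dt / R * (\<Sum>j=1..i. A i j * D_cen xf (psc j 2) k)"
proof -
  let ?P = "\<lambda>j \<epsilon>. D_cen xf (\<lambda>l. pressure \<kappa> \<gamma> (\<rho>s j \<epsilon> l)) k"
  have \<rho>s: "grid_tendsto (\<rho>s j) (\<lambda>_. R)" if "j \<in> {1..s}" for j
    using grid_limits(3)[OF that] \<rho>sc_0[OF that] by (simp add: grid_tendsto_def)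
  have \<rho>n: "((\<lambda>\<epsilon>. \<rho>n \<epsilon> k) \<longlongrightarrow> R) (at_right 0)"
    using grid_limits(1)[THEN grid_tendstoD, of k] by (simp add: \<rho>nc_0)
  have stages: "j \<in> {1..s}" if "j \<in> {1..<i} \<or> j \<in> {1..i}" for j using that i by auto
  have "((\<lambda>\<epsilon>. \<rho>n \<epsilon> k * un \<epsilon> k - dt * (\<Sum>j=1..<i. At i j * D1 (\<rho>s j \<epsilon>) (us j \<epsilon>) k)
        - dt * (\<Sum>j=1..i. A i j * (?P j \<epsilon> / \<epsilon>\<^sup>2))) \<longlongrightarrow>
      R * unc 0 k - dt * (\<Sum>j=1..<i. At i j * D1 (\<lambda>_. R) (usc j 0) k)
        - dt * (\<Sum>j=1..i. A i j * D_cen xf (psc j 2) k)) (at_right 0)"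
    by (intro tendsto_intros \<rho>n grid_limits(2)[THEN grid_tendstoD]
        tendsto_momentum_operator[OF D1 constants(2,3), THEN grid_tendstoD]
        \<rho>s grid_limits(4) pressure_gradient_tendsto stages) auto
  moreover have "momentum_rhs xf At A D1 (pressure \<kappa> \<gamma>) dt \<epsilon>
        (\<rho>n \<epsilon>) (un \<epsilon>) (\<lambda>j. \<rho>s j \<epsilon>) (\<lambda>j. us j \<epsilon>) i k =
      \<rho>n \<epsilon> k * un \<epsilon> k - dt * (\<Sum>j=1..<i. At i j * D1 (\<rho>s j \<epsilon>) (us j \<epsilon>) k)
        - dt * (\<Sum>j=1..i. A i j * (?P j \<epsilon> / \<epsilon>\<^sup>2))" for \<epsilon>
    by (simp add: momentum_rhs_def sum_divide_distrib[symmetric])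
  ultimately have rhs: "((\<lambda>\<epsilon>. momentum_rhs xf At A D1 (pressure \<kappa> \<gamma>) dt \<epsilon>
        (\<rho>n \<epsilon>) (un \<epsilon>) (\<lambda>j. \<rho>s j \<epsilon>) (\<lambda>j. us j \<epsilon>) i k) \<longlongrightarrow>
      R * unc 0 k - dt * (\<Sum>j=1..<i. At i j * D1 (\<lambda>_. R) (usc j 0) k)
        - dt * (\<Sum>j=1..i. A i j * D_cen xf (psc j 2) k)) (at_right 0)"
    by simp
  have lhs: "((\<lambda>\<epsilon>. \<rho>s i \<epsilon> k * us i \<epsilon> k) \<longlongrightarrow> R * usc i 0 k) (at_right 0)"
    by (intro tendsto_intros \<rho>s[THEN grid_tendstoD] grid_limits(4)[THEN grid_tendstoD] i)
  from tendsto_unique[OF _ formally_equal_tendsto_0[OF momentum_eq[OF i]] tendsto_diff[OF lhs rhs]]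
  have "R * usc i 0 k = R * unc 0 k - dt * (\<Sum>j=1..<i. At i j * D1 (\<lambda>_. R) (usc j 0) k)
        - dt * (\<Sum>j=1..i. A i j * D_cen xf (psc j 2) k)" (is "_ = _ - dt * ?S - dt * ?T")
    by simp
  then have "R * usc i 0 k / R = (R * unc 0 k - dt * ?S - dt * ?T) / R"
    by simp
  then have "usc i 0 k = unc 0 k - dt * (?S / R) - dt / R * ?T"
    using constants(3) by (simp add: diff_divide_distrib)
  moreover have "?S / R = (\<Sum>j=1..<i. At i j * (D1 (\<lambda>_. R) (usc j 0) k / R))"
    by (simp add: sum_divide_distrib)
  ultimately show ?thesis by (simp only:)
qed

end

section \<open>The limit of the scheme\<close>

text \<open>Averaging over a cell maps \<open>a + \<epsilon>\<^sup>2 f\<close> to \<open>a\<close> plus \<open>\<epsilon>\<^sup>2\<close> times the average of \<open>f\<close>, which has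
  no term of order 1.\<close>

lemma well_prepared_density_coeffs:
  assumes mesh: "periodic_mesh N L xf"
    and int: "f integrable_on {xf (k - 1)..xf k}"
    and init: "\<forall>\<^sub>F \<epsilon> in at_right 0. r \<epsilon> = cell_average xf (\<lambda>x. a + \<epsilon>\<^sup>2 * f x)"
    and r: "has_expansion (\<lambda>\<epsilon>. r \<epsilon> k) c"
  shows "c 0 = a" "c 1 = 0"
proof -
  have eps: "((\<lambda>\<epsilon>. \<epsilon>) \<longlongrightarrow> (0::real)) (at_right 0)" by (rule tendsto_ident_at)
  define b where "b = cell_average xf f k"
  have average: "cell_average xf (\<lambda>x. a + \<epsilon>\<^sup>2 * f x) k = a + \<epsilon>\<^sup>2 * b" for \<epsilon>
  proof -
    have "integral {xf (k - 1)..xf k} (\<lambda>x. a + \<epsilon>\<^sup>2 * f x) =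
        cell_length xf k * a + \<epsilon>\<^sup>2 * integral {xf (k - 1)..xf k} f"
      using int cell_length_pos[OF mesh, of k]
      by (subst integral_add) (auto simp: cell_length_def intro: integrable_on_mult_right)
    then show ?thesis
      using cell_length_pos[OF mesh, of k]
      by (simp add: cell_average_def b_def add_divide_distrib)
  qed
  have ev: "\<forall>\<^sub>F \<epsilon> in at_right 0. \<epsilon> > 0 \<and> r \<epsilon> k = a + \<epsilon>\<^sup>2 * b"
    using init eventually_at_right_less[of "0::real"] by eventually_elim (simp add: average)
  have "((\<lambda>\<epsilon>. a + \<epsilon>\<^sup>2 * b) \<longlongrightarrow> a + 0\<^sup>2 * b) (at_right 0)"
    by (intro tendsto_intros eps)
  then have "((\<lambda>\<epsilon>. r \<epsilon> k) \<longlongrightarrow> a + 0\<^sup>2 * b) (at_right 0)"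
    by (rule Lim_transform_eventually) (use ev in eventually_elim, simp)
  then have "((\<lambda>\<epsilon>. r \<epsilon> k) \<longlongrightarrow> a) (at_right 0)" by simp
  from tendsto_unique[OF _ has_expansion_tendsto_0[OF r] this] show c0: "c 0 = a" by simp
  have "((\<lambda>\<epsilon>. \<epsilon> * b) \<longlongrightarrow> 0 * b) (at_right 0)"
    by (intro tendsto_intros eps)
  then have "((\<lambda>\<epsilon>. (r \<epsilon> k - c 0) / \<epsilon>) \<longlongrightarrow> 0 * b) (at_right 0)"
    by (rule Lim_transform_eventually)
      (use ev in eventually_elim, simp add: c0 power2_eq_square)
  then have "((\<lambda>\<epsilon>. (r \<epsilon> k - c 0) / \<epsilon>) \<longlongrightarrow> 0) (at_right 0)" by simp
  from tendsto_unique[OF _ has_expansion_tendsto_1[OF r] this] show "c 1 = 0" by simp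
qed

theorem theorem2:
  fixes N s :: nat and L \<kappa> \<gamma> q :: real and xf :: grid
    and At A :: "nat \<Rightarrow> nat \<Rightarrow> real" and bt b ct c :: "nat \<Rightarrow> real"
    and t :: "nat \<Rightarrow> real"
    and D D1 :: "grid \<Rightarrow> grid \<Rightarrow> grid"
    and \<rho>init0 :: real and \<rho>init2 uinit0 uinit1 :: "real \<Rightarrow> real"
    and \<rho> u :: "nat \<Rightarrow> real \<Rightarrow> grid"                \<comment> \<open>time level, \<open>\<epsilon>\<close>, cell\<close>
    and \<rho>S uS :: "nat \<Rightarrow> nat \<Rightarrow> real \<Rightarrow> grid"       \<comment> \<open>time level, stage, \<open>\<epsilon>\<close>, cell\<close>
    and \<rho>c uc pc :: "nat \<Rightarrow> nat \<Rightarrow> grid"            \<comment> \<open>time level, order in \<open>\<epsilon>\<close>, cell\<close>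
    and \<rho>Sc uSc pSc :: "nat \<Rightarrow> nat \<Rightarrow> nat \<Rightarrow> grid"  \<comment> \<open>time level, stage, order in \<open>\<epsilon>\<close>, cell\<close>
  assumes constants: "\<kappa> > 0" "\<gamma> > 1" "q > 0"
    and mesh: "periodic_mesh N L xf"
    and imex: "gsa_imex_rk s At A bt b ct c"
    and time_steps: "\<And>n. t (Suc n) - t n > 0"
    and D: "D \<in> {D_cen_mass xf, D_upw_mass xf}"
    and D1: "D1 \<in> {D_upw_mom xf, D_ES_mom jump \<gamma> q xf, D_ES_mom reconstructed_jump \<gamma> q xf}"
    \<comment> \<open>well-prepared initial data, projected by cell averages\<close>
    and \<rho>init0_pos: "\<rho>init0 > 0"
    and uinit0_const: "\<And>x. (uinit0 has_real_derivative 0) (at x)"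
    and init_periodic: "\<And>x. \<rho>init2 (x + L) = \<rho>init2 x" "\<And>x. uinit0 (x + L) = uinit0 x"
      "\<And>x. uinit1 (x + L) = uinit1 x"
    and init_integrable: "\<And>k. \<rho>init2 integrable_on {xf (k - 1)..xf k}"
      "\<And>k. uinit1 integrable_on {xf (k - 1)..xf k}"
    and init_\<rho>: "\<forall>\<^sub>F \<epsilon> in at_right 0. \<rho> 0 \<epsilon> = cell_average xf (\<lambda>x. \<rho>init0 + \<epsilon>\<^sup>2 * \<rho>init2 x)"
    and init_u: "\<forall>\<^sub>F \<epsilon> in at_right 0. u 0 \<epsilon> = cell_average xf (\<lambda>x. uinit0 x + \<epsilon> * uinit1 x)"
    \<comment> \<open>periodicity and positivity\<close>
    and periodic: "\<And>n. \<forall>\<^sub>F \<epsilon> in at_right 0. periodic_grid N (\<rho> n \<epsilon>) \<and> periodic_grid N (u n \<epsilon>)"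
      "\<And>n i. i \<in> {1..s} \<Longrightarrow>
         \<forall>\<^sub>F \<epsilon> in at_right 0. periodic_grid N (\<rho>S n i \<epsilon>) \<and> periodic_grid N (uS n i \<epsilon>)"
    and positive: "\<And>n. \<forall>\<^sub>F \<epsilon> in at_right 0. \<forall>k. \<rho> n \<epsilon> k > 0"
      "\<And>n i. i \<in> {1..s} \<Longrightarrow> \<forall>\<^sub>F \<epsilon> in at_right 0. \<forall>k. \<rho>S n i \<epsilon> k > 0"
    \<comment> \<open>asymptotic expansions of density, velocity and pressure\<close>
    and expansions:
      "\<And>n k. has_expansion (\<lambda>\<epsilon>. \<rho> n \<epsilon> k) (\<lambda>m. \<rho>c n m k)"
      "\<And>n k. has_expansion (\<lambda>\<epsilon>. u n \<epsilon> k) (\<lambda>m. uc n m k)"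
      "\<And>n k. has_expansion (\<lambda>\<epsilon>. pressure \<kappa> \<gamma> (\<rho> n \<epsilon> k)) (\<lambda>m. pc n m k)"
      "\<And>n i k. i \<in> {1..s} \<Longrightarrow> has_expansion (\<lambda>\<epsilon>. \<rho>S n i \<epsilon> k) (\<lambda>m. \<rho>Sc n i m k)"
      "\<And>n i k. i \<in> {1..s} \<Longrightarrow> has_expansion (\<lambda>\<epsilon>. uS n i \<epsilon> k) (\<lambda>m. uSc n i m k)"
      "\<And>n i k. i \<in> {1..s} \<Longrightarrow>
         has_expansion (\<lambda>\<epsilon>. pressure \<kappa> \<gamma> (\<rho>S n i \<epsilon> k)) (\<lambda>m. pSc n i m k)"
    \<comment> \<open>the scheme, all powers of \<open>\<epsilon>\<close> being balanced\<close>
    and density_eq: "\<And>n i k. i \<in> {1..s} \<Longrightarrow>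
      formally_equal (\<lambda>\<epsilon>. \<rho>S n i \<epsilon> k)
        (\<lambda>\<epsilon>. density_rhs xf At A D (pressure \<kappa> \<gamma>) (t (Suc n) - t n) \<epsilon>
               (\<rho> n \<epsilon>) (u n \<epsilon>) (\<lambda>j. \<rho>S n j \<epsilon>) (\<lambda>j. uS n j \<epsilon>) i k)"
    and momentum_eq: "\<And>n i k. i \<in> {1..s} \<Longrightarrow>
      formally_equal (\<lambda>\<epsilon>. \<rho>S n i \<epsilon> k * uS n i \<epsilon> k)
        (\<lambda>\<epsilon>. momentum_rhs xf At A D1 (pressure \<kappa> \<gamma>) (t (Suc n) - t n) \<epsilon>
               (\<rho> n \<epsilon>) (u n \<epsilon>) (\<lambda>j. \<rho>S n j \<epsilon>) (\<lambda>j. uS n j \<epsilon>) i k)"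
    and update: "\<And>n. \<forall>\<^sub>F \<epsilon> in at_right 0. \<rho> (Suc n) \<epsilon> = \<rho>S n s \<epsilon> \<and> u (Suc n) \<epsilon> = uS n s \<epsilon>"
  shows "(\<exists>C. \<forall>n. \<forall>i\<in>{1..s}. \<forall>k. \<rho>Sc n i 0 k = C) \<and>
    (\<exists>C. \<forall>n. \<forall>i\<in>{1..s}. \<forall>k. \<rho>Sc n i 1 k = C) \<and>
    (\<forall>\<epsilon>>0. \<forall>k0. \<forall>\<rho>0. \<rho>0 = \<rho>c 0 0 k0 + \<epsilon> * \<rho>c 0 1 k0 \<longrightarrow>
      (\<forall>n. \<forall>i\<in>{1..s}. \<forall>k.
         \<rho>Sc n i 0 k + \<epsilon> * \<rho>Sc n i 1 k = \<rho>0 \<and>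
         uSc n i 0 k = uc n 0 k
           - (t (Suc n) - t n) * (\<Sum>j=1..<i. At i j * (D1 (\<lambda>_. \<rho>0) (uSc n j 0) k / \<rho>0))
           - (t (Suc n) - t n) / \<rho>0 * (\<Sum>j=1..i. A i j * D_cen xf (pSc n j 2) k)))"
proof -
  have s: "s \<in> {1..s}" and A: "\<And>i. i \<in> {1..s} \<Longrightarrow> A i i \<noteq> 0"
    using imex by (auto simp: gsa_imex_rk_def)
  have step: "expanded_time_step N s L \<kappa> \<gamma> q (t (Suc n) - t n) \<rho>init0 0 xf At A D D1
      (\<rho> n) (u n) (\<rho>S n) (uS n) (\<rho>c n) (uc n) (\<rho>Sc n) (uSc n) (pSc n)"
    if "\<And>k. \<rho>c n 0 k = \<rho>init0" "\<And>k. \<rho>c n 1 k = 0" for n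
    by unfold_locales (fact constants \<rho>init0_pos time_steps mesh A D D1 periodic positive
        expansions density_eq momentum_eq that)+
  have level: "(\<forall>k. \<rho>c n 0 k = \<rho>init0) \<and> (\<forall>k. \<rho>c n 1 k = 0)" for n
  proof (induction n)
    case 0
    show ?case
      using well_prepared_density_coeffs[OF mesh init_integrable(1) init_\<rho> expansions(1)] by simp
  next
    case (Suc n)
    then interpret expanded_time_step N s L \<kappa> \<gamma> q "t (Suc n) - t n" \<rho>init0 0 xf At A D D1
      "\<rho> n" "u n" "\<rho>S n" "uS n" "\<rho>c n" "uc n" "\<rho>Sc n" "uSc n" "pSc n"
      by (intro step) auto
    have "\<forall>\<^sub>F \<epsilon> in at_right 0. \<rho> (Suc n) \<epsilon> k = \<rho>S n s \<epsilon> k" for k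
      using update[of n] by eventually_elim simp
    from eventually_eq_imp_coeffs_eq[OF this expansions(1) expansions(4)[OF s]]
    have "\<rho>c (Suc n) m k = \<rho>Sc n s m k" for m k .
    then show ?case using \<rho>sc_0[OF s] \<rho>sc_1[OF s] by simp
  qed
  note steps = step[OF level[THEN conjunct1, rule_format] level[THEN conjunct2, rule_format]]
  note \<rho>0 = expanded_time_step.\<rho>sc_0[OF steps] and \<rho>1 = expanded_time_step.\<rho>sc_1[OF steps]
    and u0 = expanded_time_step.usc_0[OF steps]
  have init: "\<rho>c 0 0 k = \<rho>init0" "\<rho>c 0 1 k = 0" for k
    using level[of 0] by auto
  show ?thesis
  proof (intro conjI allI impI ballI)
    show "\<exists>C. \<forall>n. \<forall>i\<in>{1..s}. \<forall>k. \<rho>Sc n i 0 k = C" using \<rho>0 by blast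
    show "\<exists>C. \<forall>n. \<forall>i\<in>{1..s}. \<forall>k. \<rho>Sc n i 1 k = C" using \<rho>1 by blast
  next
    fix \<epsilon> :: real and k0 k :: int and \<rho>0' n i
    assume "\<rho>0' = \<rho>c 0 0 k0 + \<epsilon> * \<rho>c 0 1 k0" and i: "i \<in> {1..s}"
    then have eq: "\<rho>0' = \<rho>init0" by (simp only: init)
    show "\<rho>Sc n i 0 k + \<epsilon> * \<rho>Sc n i 1 k = \<rho>0'"
      by (simp only: eq \<rho>0[OF i] \<rho>1[OF i])
    show "uSc n i 0 k = uc n 0 k
        - (t (Suc n) - t n) * (\<Sum>j=1..<i. At i j * (D1 (\<lambda>_. \<rho>0') (uSc n j 0) k / \<rho>0'))
        - (t (Suc n) - t n) / \<rho>0' * (\<Sum>j=1..i. A i j * D_cen xf (pSc n j 2) k)"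
      unfolding eq by (rule u0[OF i])
  qed
qed

end
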